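(* Let $p_0$ be a probability mass function (pmf) on $\mathbb{N}=\{0,1,2,\dots\}$ whose support is $\{0,\dots,S\}$ for some integer $S>0$, and assume that $p_0$ is convex on $\mathbb{N}$. Let $X_1,\dots,X_n$ be i.i.d. with pmf $p_0$, let $p_n$ be their empirical pmf, and let $\hat p_n$ be the least-squares projection of $p_n$ onto the set of convex pmfs on $\mathbb{N}$. Then, as $n\to\infty$, $$T_n^2 = n\,\|p_n-\hat p_n\|^2 \xrightarrow{d} \hat T_0:=\sum_{k=0}^{S+1}\big(\hat g_0(k)-g_0(k)\big)^2 ,$$ where $g_0$ and $\hat g_0$ are defined below.
   Context: The empirical pmf is $p_n(j)=n^{-1}\sum_{i=1}^n \mathbb{1}_{\{X_i=j\}}$, $j\in\mathbb{N}$. For a sequence $q=(q(j))_{j\in\mathbb{N}}$, $\|q\|^2=\sum_{j\in\mathbb{N}}q(j)^2$. For a sequence $p$ and $k\geq 1$, $\Delta p(k)=p(k+1)-2p(k)+p(k-1)$; $p$ is convex on $\mathbb{N}$ iff $\Delta p(k)\ge 0$ for all $k\ge 1$. An integer $k\geq1$ is a knot of $p$ if $\Delta p(k)>0$. $\hat p_n$ denotes the (unique) minimizer of $\|p_n-p\|^2$ over all convex pmfs $p$ on $\mathbb{N}$, and $T_n=\sqrt n\,\|p_n-\hat p_n\|$. $g_0=(g_0(0),\dots,g_0(S+1))$ is a centered Gaussian vector in $\mathbb{R}^{S+2}$ with $\mathrm{Cov}(g_0(i),g_0(j))=\mathbb{1}_{\{i=j\}}p_0(i)-p_0(i)p_0(j)$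 for $i,j=0,\dots,S+1$. $\mathcal K_0$ is the set of all $g=(g(0),\dots,g(S+1))\in\mathbb{R}^{S+2}$ such that $\Delta g(k)=g(k+1)-2g(k)+g(k-1)\geq 0$ for all $k\in\{1,\dots,S\}$, with possible exceptions at those $k$ that are knots of $p_0$. $\hat g_0$ is the (unique) minimizer of $\sum_{k=0}^{S+1}(g(k)-g_0(k))^2$ over $g\in\mathcal K_0$. *)

theory Defs
  imports "HOL-Probability.Probability"
begin

text \<open>Second difference of a sequence on the naturals (used for k \<ge> 1).\<close>
definition Delta2 :: "(nat \<Rightarrow> real) \<Rightarrow> nat \<Rightarrow> real" where
  "Delta2 p k = p (k + 1) - 2 * p k + p (k - 1)"

definition convex_seq :: "(nat \<Rightarrow> real) \<Rightarrow> bool" where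
  "convex_seq p \<longleftrightarrow> (\<forall>k\<ge>1. Delta2 p k \<ge> 0)"

definition is_pmf :: "(nat \<Rightarrow> real) \<Rightarrow> bool" where
  "is_pmf p \<longleftrightarrow> (\<forall>j. p j \<ge> 0) \<and> (p has_sum 1) UNIV"

definition convex_pmfs :: "(nat \<Rightarrow> real) set" where
  "convex_pmfs = {p. is_pmf p \<and> convex_seq p}"

definition sqnorm :: "(nat \<Rightarrow> real) \<Rightarrow> real" where
  "sqnorm q = (\<Sum>\<^sub>\<infinity>j. (q j)\<^sup>2)"

definition knot :: "(nat \<Rightarrow> real) \<Rightarrow> nat \<Rightarrow> bool" where
  "knot p k \<longleftrightarrow> k \<ge> 1 \<and> Delta2 p k > 0"

definition emp_pmf :: "(nat \<Rightarrow> 'a \<Rightarrow> nat) \<Rightarrow> nat \<Rightarrow> 'a \<Rightarrow> nat \<Rightarrow> real" where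
  "emp_pmf X n \<omega> j = real (card {i \<in> {1..n}. X i \<omega> = j}) / real n"

definition ls_proj :: "(nat \<Rightarrow> real) \<Rightarrow> (nat \<Rightarrow> real)" where
  "ls_proj q = (THE p. p \<in> convex_pmfs \<and>
      (\<forall>p'\<in>convex_pmfs. sqnorm (\<lambda>j. q j - p j) \<le> sqnorm (\<lambda>j. q j - p' j)))"

definition Tn_sq :: "(nat \<Rightarrow> 'a \<Rightarrow> nat) \<Rightarrow> nat \<Rightarrow> 'a \<Rightarrow> real" where
  "Tn_sq X n \<omega> = real n * sqnorm (\<lambda>j. emp_pmf X n \<omega> j - ls_proj (emp_pmf X n \<omega>) j)"

definition centered_gaussian_rv :: "'b measure \<Rightarrow> ('b \<Rightarrow> real) \<Rightarrow> real \<Rightarrow> bool" where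
  "centered_gaussian_rv N Y v \<longleftrightarrow>
     (v = 0 \<and> Y \<in> borel_measurable N \<and> (AE \<omega> in N. Y \<omega> = 0)) \<or>
     (v > 0 \<and> distributed N lborel Y (normal_density 0 (sqrt v)))"

definition centered_gaussian_vector ::
  "'b measure \<Rightarrow> nat set \<Rightarrow> ('b \<Rightarrow> nat \<Rightarrow> real) \<Rightarrow> (nat \<Rightarrow> nat \<Rightarrow> real) \<Rightarrow> bool" where
  "centered_gaussian_vector N I G C \<longleftrightarrow>
     (\<forall>c :: nat \<Rightarrow> real. centered_gaussian_rv N (\<lambda>\<omega>. \<Sum>k\<in>I. c k * G \<omega> k)
        (\<Sum>i\<in>I. \<Sum>j\<in>I. c i * c j * C i j))"

text \<open>The cone K_0 (vectors (g(0),...,g(S+1)) encoded as sequences vanishing beyond S+1).\<close>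
definition K0 :: "(nat \<Rightarrow> real) \<Rightarrow> nat \<Rightarrow> (nat \<Rightarrow> real) set" where
  "K0 p0 S = {g. (\<forall>k>S+1. g k = 0) \<and>
      (\<forall>k\<in>{1..S}. \<not> knot p0 k \<longrightarrow> Delta2 g k \<ge> 0)}"

definition proj_K0 :: "(nat \<Rightarrow> real) \<Rightarrow> nat \<Rightarrow> (nat \<Rightarrow> real) \<Rightarrow> (nat \<Rightarrow> real)" where
  "proj_K0 p0 S g0 = (THE g. g \<in> K0 p0 S \<and>
      (\<forall>g'\<in>K0 p0 S. (\<Sum>k=0..S+1. (g k - g0 k)\<^sup>2) \<le> (\<Sum>k=0..S+1. (g' k - g0 k)\<^sup>2)))"

definition T0_hat :: "(nat \<Rightarrow> real) \<Rightarrow> nat \<Rightarrow> (nat \<Rightarrow> real) \<Rightarrow> real" where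
  "T0_hat p0 S g0 = (\<Sum>k=0..S+1. (proj_K0 p0 S g0 k - g0 k)\<^sup>2)"

end

theory Submission
  imports Defs
begin

text \<open>
  Let \<open>x = p\<^sub>n - p\<^sub>0\<close> on \<open>{0..S+1}\<close> and let \<open>g\<close> be the projection of \<open>x\<close> onto the cone \<open>K\<^sub>0\<close>.
  If \<open>x\<close> is small, then \<open>p\<^sub>0 + g\<close> is itself a convex pmf: the cone contains the constants in both
  directions, so the total mass is preserved, and it contains the indicator of \<open>S + 1\<close>, so
  \<open>g (S + 1) \<ge> x (S + 1) = 0\<close>; all other constraints are strict at \<open>p\<^sub>0\<close> or part of \<open>K\<^sub>0\<close>. Conversely
  \<open>p - p\<^sub>0\<close> lies in \<open>K\<^sub>0\<close> for every convex pmf \<open>p\<close>. Hence the least-squares projection of \<open>p\<^sub>n\<close> is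
  exactly \<open>p\<^sub>0 + g\<close> with probability tending to one, and by homogeneity the statistic is then the squared
  distance of \<open>\<surd>n (p\<^sub>n - p\<^sub>0)\<close> to \<open>K\<^sub>0\<close>. The distance is Lipschitz, so the multivariate central limit
  theorem, obtained from the one-dimensional one by the Cramer-Wold device, gives the limit.
\<close>

section \<open>Convergence of Lipschitz expectations\<close>

text \<open>Each generator sees \<open>x\<close> only through one linear form, and that is exactly
  what one-dimensional weak convergence controls. The phase \<open>b\<close> brings in the sines,
  and product formulas turn these finite sums into an algebra.\<close>

inductive_set trig_poly :: "'i set \<Rightarrow> (('i \<Rightarrow> real) \<Rightarrow> real) set" for I where
  cos: "(\<lambda>x. a * cos ((\<Sum>k\<in>I. c k * x k) + b)) \<in> trig_poly I"
| add: "f \<in> trig_poly I \<Longrightarrow> g \<in> trig_poly I \<Longrightarrow> (\<lambda>x. f x + g x) \<in> trig_poly I"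

lemma trig_poly_const: "(\<lambda>x. a) \<in> trig_poly I"
  using trig_poly.cos[where a = a and c = "\<lambda>_. 0" and b = 0] by simp

lemma trig_poly_sin:
  assumes "finite I" "j \<in> I"
  shows "(\<lambda>x. sin (r * x j)) \<in> trig_poly I"
proof -
  have "(\<Sum>k\<in>I. (if k = j then r else 0) * x k) = r * x j" for x :: "'a \<Rightarrow> real"
    using assms by (simp add: if_distrib[of "\<lambda>t. t * _"] cong: if_cong)
  moreover have "cos (r * x j - pi / 2) = sin (r * x j)" for x :: "'a \<Rightarrow> real"
    by (simp add: cos_diff)
  ultimately show ?thesis
    using trig_poly.cos[where a = 1 and I = I and c = "\<lambda>k. if k = j then r else 0" and b = "- (pi / 2)"] by simp
qed

text \<open>Product-to-sum formula for two cosines; the two nested inductions extend it bilinearly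
  to sums.\<close>

lemma trig_poly_mult:
  assumes "f \<in> trig_poly I" "g \<in> trig_poly I"
  shows "(\<lambda>x. f x * g x) \<in> trig_poly I"
  using assms(1)
proof induction
  case (cos a c b)
  show ?case
    using assms(2)
  proof induction
    case (cos a' c' b')
    have "a * cos ((\<Sum>k\<in>I. c k * x k) + b) * (a' * cos ((\<Sum>k\<in>I. c' k * x k) + b')) =
        (a * a' / 2) * cos ((\<Sum>k\<in>I. (c k - c' k) * x k) + (b - b')) +
        (a * a' / 2) * cos ((\<Sum>k\<in>I. (c k + c' k) * x k) + (b + b'))" for x
    proof -
      define u v where "u = (\<Sum>k\<in>I. c k * x k) + b" and "v = (\<Sum>k\<in>I. c' k * x k) + b'"
      have "(\<Sum>k\<in>I. (c k - c' k) * x k) + (b - b') = u - v"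
        by (simp add: u_def v_def algebra_simps sum_subtractf)
      moreover have "(\<Sum>k\<in>I. (c k + c' k) * x k) + (b + b') = u + v"
        by (simp add: u_def v_def algebra_simps sum.distrib)
      moreover have "a * cos u * (a' * cos v) = a * a' / 2 * cos (u - v) + a * a' / 2 * cos (u + v)"
        by (simp add: cos_add cos_diff algebra_simps)
      ultimately show ?thesis
        by (simp only: u_def v_def)
    qed
    then show ?case
      by (simp only:) (intro trig_poly.intros)
  next
    case (add g h)
    then show ?case
      using trig_poly.add[OF add.IH] by (simp add: algebra_simps)
  qed
next
  case (add f h)
  then show ?case
    using trig_poly.add[OF add.IH] by (simp add: algebra_simps)
qed

text \<open>The approximating sequence may change with \<open>e\<close>, as long as its error is
  uniform in \<open>n\<close>. This serves twice below: for polynomial approximation on the cube and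
  for replacing coordinates by sines.\<close>

lemma LIMSEQ_uniform_approx:
  fixes a :: "nat \<Rightarrow> real"
  assumes "\<And>e. e > 0 \<Longrightarrow> \<exists>b b'. b \<longlonglongrightarrow> b' \<and> (\<forall>n. \<bar>a n - b n\<bar> \<le> e) \<and> \<bar>a' - b'\<bar> \<le> e"
  shows "a \<longlonglongrightarrow> a'"
proof (rule LIMSEQ_I)
  fix e :: real assume "e > 0"
  then obtain b b' where b: "b \<longlonglongrightarrow> b'" "\<forall>n. \<bar>a n - b n\<bar> \<le> e / 4" "\<bar>a' - b'\<bar> \<le> e / 4"
    using assms[of "e / 4"] by auto
  obtain n0 where n0: "\<And>n. n \<ge> n0 \<Longrightarrow> norm (b n - b') < e / 4"
    using LIMSEQ_D[OF b(1), of "e / 4"] \<open>e > 0\<close> by auto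
  have "norm (a n - a') < e" if "n \<ge> n0" for n
    using b(2)[rule_format, of n] b(3) n0[OF that] \<open>e > 0\<close> unfolding real_norm_def by arith
  then show "\<exists>n0. \<forall>n\<ge>n0. norm (a n - a') < e" by blast
qed

section \<open>Functions of finitely many coordinates: continuity, measurability,
  compactness\<close>

lemma integral_diff_bound:
  fixes f g :: "'a \<Rightarrow> real"
  assumes "integrable M f" "integrable M g" "integrable M h" "\<And>\<omega>. \<omega> \<in> space M \<Longrightarrow> \<bar>f \<omega> - g \<omega>\<bar> \<le> h \<omega>"
  shows "\<bar>(\<integral>\<omega>. f \<omega> \<partial>M) - (\<integral>\<omega>. g \<omega> \<partial>M)\<bar> \<le> (\<integral>\<omega>. h \<omega> \<partial>M)"
proof -
  have "(\<integral>\<omega>. f \<omega> \<partial>M) - (\<integral>\<omega>. g \<omega> \<partial>M) = (\<integral>\<omega>. f \<omega> - g \<omega> \<partial>M)"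
    using assms by simp
  also have "\<bar>\<dots>\<bar> \<le> (\<integral>\<omega>. \<bar>f \<omega> - g \<omega>\<bar> \<partial>M)"
    by (rule integral_abs_bound)
  also have "\<dots> \<le> (\<integral>\<omega>. h \<omega> \<partial>M)"
    using assms by (intro integral_mono) auto
  finally show ?thesis .
qed

text \<open>In the product topology each coordinate is continuous, so the bounding sum over
  \<open>I\<close> tends to 0 at every point.\<close>

lemma continuous_on_lipschitz_coordinates:
  fixes f :: "('i \<Rightarrow> real) \<Rightarrow> real"
  assumes lip: "\<And>x y. \<bar>f x - f y\<bar> \<le> K * (\<Sum>k\<in>I. \<bar>x k - y k\<bar>)"
  shows "continuous_on A f"
proof (rule continuous_on_subset[of UNIV], unfold continuous_on_def, intro ballI)
  fix a :: "'i \<Rightarrow> real"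
  have coord: "((\<lambda>x. x k) \<longlongrightarrow> a k) (at a)" for k
    using continuous_on_product_coordinates[of k] unfolding continuous_on_def by blast
  have "((\<lambda>x. K * (\<Sum>k\<in>I. \<bar>x k - a k\<bar>)) \<longlongrightarrow> K * (\<Sum>k\<in>I. \<bar>a k - a k\<bar>)) (at a)"
    by (intro tendsto_intros coord)
  then have "((\<lambda>x. K * (\<Sum>k\<in>I. \<bar>x k - a k\<bar>)) \<longlongrightarrow> 0) (at a)" by simp
  then have "((\<lambda>x. f x - f a) \<longlongrightarrow> 0) (at a)"
    by (rule Lim_null_comparison[rotated]) (simp add: lip)
  then show "(f \<longlongrightarrow> f a) (at a within UNIV)"
    by (simp add: Lim_null[symmetric])
qed simp

lemma borel_measurable_lipschitz_coordinates:
  fixes f :: "('i::countable \<Rightarrow> real) \<Rightarrow> real"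
  assumes lip: "\<And>x y. \<bar>f x - f y\<bar> \<le> K * (\<Sum>k\<in>I. \<bar>x k - y k\<bar>)"
    and meas: "\<And>k. k \<in> I \<Longrightarrow> (\<lambda>\<omega>. V \<omega> k) \<in> borel_measurable M"
  shows "(\<lambda>\<omega>. f (V \<omega>)) \<in> borel_measurable M"
proof -
  \<comment> \<open>Coordinates outside \<open>I\<close> may fail to be measurable. Setting them to
    0 does not change \<open>f\<close>, because the Lipschitz bound involves only coordinates in
    \<open>I\<close>.\<close>
  define W where "W \<omega> k = (if k \<in> I then V \<omega> k else 0)" for \<omega> k
  have W: "W \<in> borel_measurable M"
  proof (rule measurable_coordinatewise_then_product)
    show "(\<lambda>\<omega>. W \<omega> k) \<in> borel_measurable M" for k
      using meas[of k] by (cases "k \<in> I") (auto simp: W_def)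
  qed
  have "f \<in> borel_measurable borel"
    by (intro borel_measurable_continuous_onI continuous_on_lipschitz_coordinates[OF lip])
  then have "(\<lambda>\<omega>. f (W \<omega>)) \<in> borel_measurable M"
    using W by measurable
  moreover have "f (W \<omega>) = f (V \<omega>)" for \<omega>
    using lip[of "W \<omega>" "V \<omega>"] by (simp add: W_def)
  ultimately show ?thesis by simp
qed

text \<open>Maclaurin expansion stopped at order two, so that the error is controlled by second
  moments.\<close>

lemma abs_diff_sin_le: "\<bar>y - sin y\<bar> \<le> y\<^sup>2" for y :: real
  using Maclaurin_sin_bound[of y 2]
  by (simp add: numeral_2_eq_2 sin_coeff_def abs_minus_commute) (smt (verit) power2_abs zero_le_power2 abs_mult_self_eq power2_eq_square)

text \<open>Tychonoff's theorem, transferred to the topology on functions.\<close>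

lemma compact_coordinatewise:
  fixes A :: "'i \<Rightarrow> real set"
  assumes "\<And>k. compact (A k)"
  shows "compact {x. \<forall>k. x k \<in> A k}"
proof -
  have "compactin (product_topology (\<lambda>_. euclidean) UNIV) (PiE UNIV A)"
    using assms by (simp add: compactin_PiE)
  then show ?thesis
    by (simp add: euclidean_product_topology PiE_UNIV_domain Pi_def)
qed

lemma trig_poly_bounded: "f \<in> trig_poly I \<Longrightarrow> \<exists>C. \<forall>x. \<bar>f x\<bar> \<le> C"
proof (induction rule: trig_poly.induct)
  case (cos a c b)
  have "\<bar>a * cos ((\<Sum>k\<in>I. c k * x k) + b)\<bar> \<le> \<bar>a\<bar> * 1" for x
    unfolding abs_mult by (intro mult_left_mono) auto
  then show ?case by blast
next
  case (add f g)
  then obtain C D where "\<And>x. \<bar>f x\<bar> \<le> C" "\<And>x. \<bar>g x\<bar> \<le> D" by blast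
  then have "\<bar>f x + g x\<bar> \<le> C + D" for x
    by (meson abs_triangle_ineq add_mono order_trans)
  then show ?case by blast
qed

lemma trig_poly_integrable:
  assumes "prob_space M" "f \<in> trig_poly I" "\<And>k. k \<in> I \<Longrightarrow> (\<lambda>\<omega>. V \<omega> k) \<in> borel_measurable M"
  shows "integrable M (\<lambda>\<omega>. f (V \<omega>))"
proof -
  interpret prob_space M by fact
  have [measurable]: "(\<lambda>\<omega>. f (V \<omega>)) \<in> borel_measurable M"
    using assms(2) by induction (auto intro!: borel_measurable_add borel_measurable_times
        borel_measurable_const borel_measurable_sum assms(3) measurable_compose[OF _ borel_measurable_cos])
  obtain C where "\<And>x. \<bar>f x\<bar> \<le> C" using trig_poly_bounded[OF assms(2)] by blast
  then show ?thesis by (intro integrable_const_bound[of _ C]) auto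
qed

text \<open>
  Since \<open>\<bar>y - L sin (y / L)\<bar> \<le> y\<^sup>2 / L\<close>, the bounded second moments allow replacing \<open>f x\<close> by
  \<open>f (L sin (x / L))\<close>. This is a continuous function of sines, hence by Stone-Weierstrass on the cube a
  uniform limit of polynomials in sines, that is of trigonometric polynomials, whose expectations
  depend on linear combinations of the coordinates only. No separate tightness argument is needed.
\<close>

theorem cramer_wold_lipschitz:
  fixes V :: "nat \<Rightarrow> 'a \<Rightarrow> 'i::countable \<Rightarrow> real" and G :: "'b \<Rightarrow> 'i \<Rightarrow> real"
  assumes "prob_space M" "prob_space N" and fin: "finite I"
    and V: "\<And>n k. k \<in> I \<Longrightarrow> (\<lambda>\<omega>. V n \<omega> k) \<in> borel_measurable M"
    and G: "\<And>k. k \<in> I \<Longrightarrow> (\<lambda>\<omega>. G \<omega> k) \<in> borel_measurable N"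
    and conv: "\<And>c. weak_conv_m (\<lambda>n. distr M borel (\<lambda>\<omega>. \<Sum>k\<in>I. c k * V n \<omega> k))
                  (distr N borel (\<lambda>\<omega>. \<Sum>k\<in>I. c k * G \<omega> k))"
    and V2: "\<And>n k. k \<in> I \<Longrightarrow> integrable M (\<lambda>\<omega>. (V n \<omega> k)\<^sup>2)"
            "\<And>n k. k \<in> I \<Longrightarrow> (\<integral>\<omega>. (V n \<omega> k)\<^sup>2 \<partial>M) \<le> B"
    and G2: "\<And>k. k \<in> I \<Longrightarrow> integrable N (\<lambda>\<omega>. (G \<omega> k)\<^sup>2)"
            "\<And>k. k \<in> I \<Longrightarrow> (\<integral>\<omega>. (G \<omega> k)\<^sup>2 \<partial>N) \<le> B"
    and lip: "\<And>x y. \<bar>f x - f y\<bar> \<le> K * (\<Sum>k\<in>I. \<bar>x k - y k\<bar>)"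
    and bdd: "\<And>x. \<bar>f x\<bar> \<le> C"
  shows "(\<lambda>n. \<integral>\<omega>. f (V n \<omega>) \<partial>M) \<longlonglongrightarrow> (\<integral>\<omega>. f (G \<omega>) \<partial>N)"
proof -
  interpret M: prob_space M by fact
  interpret N: prob_space N by fact
  note [measurable] = V G
  \<comment> \<open>A single cosine is a bounded continuous function of one linear combination, so
    \<open>conv\<close> applies to it; sums follow by linearity.\<close>
  have trig: "(\<lambda>n. \<integral>\<omega>. h (V n \<omega>) \<partial>M) \<longlonglongrightarrow> (\<integral>\<omega>. h (G \<omega>) \<partial>N)" if "h \<in> trig_poly I" for h
    using that
  proof induction
    case (cos a c b)
    have "(\<lambda>n. \<integral>x. a * cos (x + b) \<partial>distr M borel (\<lambda>\<omega>. \<Sum>k\<in>I. c k * V n \<omega> k))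
        \<longlonglongrightarrow> (\<integral>x. a * cos (x + b) \<partial>distr N borel (\<lambda>\<omega>. \<Sum>k\<in>I. c k * G \<omega> k))"
    proof (rule weak_conv_imp_integral_bdd_continuous_conv[OF _ _ conv, where B = "\<bar>a\<bar>"])
      show "norm (a * cos (x + b)) \<le> \<bar>a\<bar>" for x
        using mult_left_mono[OF abs_cos_le_one[of "x + b"], of "\<bar>a\<bar>"] by (simp add: abs_mult)
    qed (auto intro!: M.real_distribution_distr N.real_distribution_distr continuous_intros)
    then show ?case
      by (subst (asm) (1 2) integral_distr) auto
  next
    case (add g h)
    have "integrable M (\<lambda>\<omega>. g (V n \<omega>))" "integrable M (\<lambda>\<omega>. h (V n \<omega>))"
         "integrable N (\<lambda>\<omega>. g (G \<omega>))" "integrable N (\<lambda>\<omega>. h (G \<omega>))" for n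
      using trig_poly_integrable[where I = I and V = "V n", OF M.prob_space_axioms _ V]
        trig_poly_integrable[where I = I and V = G, OF N.prob_space_axioms _ G] add.hyps by blast+
    then show ?case
      using tendsto_add[OF add.IH] by simp
  qed
  have intV: "integrable M (\<lambda>\<omega>. f (V n \<omega>))" for n
    using borel_measurable_lipschitz_coordinates[OF lip V] bdd
    by (intro M.integrable_const_bound[of _ C]) auto
  have intG: "integrable N (\<lambda>\<omega>. f (G \<omega>))"
    using borel_measurable_lipschitz_coordinates[OF lip G] bdd
    by (intro N.integrable_const_bound[of _ C]) auto
  define T where "T L x = (\<lambda>k. if k \<in> I then L * sin (x k / L) else 0)" for L and x :: "'i \<Rightarrow> real"
  have intTV: "integrable M (\<lambda>\<omega>. f (T L (V n \<omega>)))" for L n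
    using borel_measurable_lipschitz_coordinates[OF lip, of "\<lambda>\<omega>. T L (V n \<omega>)"] bdd
    by (intro M.integrable_const_bound[of _ C]) (auto simp: T_def)
  have intTG: "integrable N (\<lambda>\<omega>. f (T L (G \<omega>)))" for L
    using borel_measurable_lipschitz_coordinates[OF lip, of "\<lambda>\<omega>. T L (G \<omega>)"] bdd
    by (intro N.integrable_const_bound[of _ C]) (auto simp: T_def)
  have stepA: "(\<lambda>n. \<integral>\<omega>. f (T L (V n \<omega>)) \<partial>M) \<longlonglongrightarrow> (\<integral>\<omega>. f (T L (G \<omega>)) \<partial>N)" if "L > 0" for L
  proof (rule LIMSEQ_uniform_approx)
    fix e :: real assume "e > 0"
    \<comment> \<open>Coordinates outside \<open>I\<close> are pinned to 0, so two distinct points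
      of the cube differ in some coordinate from \<open>I\<close>.\<close>
    define Q where "Q = {y :: 'i \<Rightarrow> real. \<forall>k. y k \<in> (if k \<in> I then {-1..1} else {0})}"
    define s where "s x = (\<lambda>k. if k \<in> I then sin (1 / L * x k) else 0)" for x :: "'i \<Rightarrow> real"
    \<comment> \<open>Functions on the cube whose pullback along the sine map \<open>s\<close> is a
      trigonometric polynomial. They form an algebra containing the constants and the coordinates in
      \<open>I\<close>, which separate points.\<close>
    define R where "R = {P. continuous_on Q P \<and> (\<lambda>x. P (s x)) \<in> trig_poly I}"
    interpret R: function_ring_on R Q
    proof
      show "compact Q" unfolding Q_def by (intro compact_coordinatewise) auto
      fix x y assume xy: "x \<in> Q" "y \<in> Q" "x \<noteq> y"
      then obtain k where k: "x k \<noteq> y k" by blast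
      with xy have "k \<in> I" unfolding Q_def by (metis (mono_tags, lifting) mem_Collect_eq singletonD)
      have "continuous_on Q (\<lambda>x. x k)"
        by (rule continuous_on_subset[OF continuous_on_product_coordinates]) simp
      with \<open>k \<in> I\<close> have kR: "(\<lambda>x. x k) \<in> R"
        using trig_poly_sin[OF fin, of k "1 / L"] by (simp add: R_def s_def)
      show "\<exists>f\<in>R. f x \<noteq> f y" by (rule bexI[OF _ kR]) (rule k)
    next
      show "(\<lambda>x. f x + g x) \<in> R" "(\<lambda>x. f x * g x) \<in> R" if "f \<in> R" "g \<in> R" for f g
        using that unfolding R_def
        by (simp_all add: continuous_on_add continuous_on_mult trig_poly.add trig_poly_mult)
    qed (simp_all add: R_def trig_poly_const)
    have "continuous_on Q (\<lambda>y. f (\<lambda>k. L * y k))"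
    proof (rule continuous_on_lipschitz_coordinates)
      show "\<bar>f (\<lambda>k. L * x k) - f (\<lambda>k. L * y k)\<bar> \<le> (K * L) * (\<Sum>k\<in>I. \<bar>x k - y k\<bar>)" for x y
        using lip[of "\<lambda>k. L * x k" "\<lambda>k. L * y k"] \<open>L > 0\<close>
        by (simp add: right_diff_distrib[symmetric] abs_mult sum_distrib_left mult.assoc)
    qed
    from R.Stone_Weierstrass_basic[OF this \<open>e > 0\<close>] obtain P where
      P: "P \<in> R" "\<And>y. y \<in> Q \<Longrightarrow> \<bar>f (\<lambda>k. L * y k) - P y\<bar> < e" by blast
    define h where "h x = P (s x)" for x
    have h: "h \<in> trig_poly I" using P(1) by (simp add: R_def h_def[abs_def])
    have "s x \<in> Q" for x by (auto simp: s_def Q_def)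
    moreover have "(\<lambda>k. L * s x k) = T L x" for x by (auto simp: T_def s_def)
    ultimately have close: "\<bar>f (T L x) - h x\<bar> \<le> e" for x
      using P(2)[of "s x"] by (simp add: h_def less_imp_le)
    have "\<bar>(\<integral>\<omega>. f (T L (V n \<omega>)) \<partial>M) - (\<integral>\<omega>. h (V n \<omega>) \<partial>M)\<bar> \<le> (\<integral>\<omega>. e \<partial>M)" for n
      by (intro integral_diff_bound intTV trig_poly_integrable[OF _ h] V M.prob_space_axioms close) auto
    moreover have "\<bar>(\<integral>\<omega>. f (T L (G \<omega>)) \<partial>N) - (\<integral>\<omega>. h (G \<omega>) \<partial>N)\<bar> \<le> (\<integral>\<omega>. e \<partial>N)"
      by (intro integral_diff_bound intTG trig_poly_integrable[OF _ h] G N.prob_space_axioms close) auto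
    ultimately show "\<exists>b b'. b \<longlonglongrightarrow> b' \<and> (\<forall>n. \<bar>(\<integral>\<omega>. f (T L (V n \<omega>)) \<partial>M) - b n\<bar> \<le> e)
        \<and> \<bar>(\<integral>\<omega>. f (T L (G \<omega>)) \<partial>N) - b'\<bar> \<le> e"
      using trig[OF h] by (intro exI conjI) (auto simp: M.prob_space N.prob_space)
  qed
  \<comment> \<open>\<open>K\<close> may be negative, for instance when \<open>I\<close> is empty;
    monotonicity arguments need a nonnegative constant.\<close>
  define K' where "K' = max K 0"
  have close: "\<bar>f x - f (T L x)\<bar> \<le> K' / L * (\<Sum>k\<in>I. (x k)\<^sup>2)" if "L > 0" for L x
  proof -
    have "\<bar>x k - T L x k\<bar> \<le> (x k)\<^sup>2 / L" if "k \<in> I" for k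
    proof -
      have "\<bar>x k - T L x k\<bar> = L * \<bar>x k / L - sin (x k / L)\<bar>"
        using \<open>L > 0\<close> that by (simp add: T_def abs_mult_pos' right_diff_distrib)
      also have "\<dots> \<le> L * (x k / L)\<^sup>2"
        using \<open>L > 0\<close> by (intro mult_left_mono abs_diff_sin_le) auto
      also have "\<dots> = (x k)\<^sup>2 / L"
        using \<open>L > 0\<close> by (simp add: power2_eq_square)
      finally show ?thesis .
    qed
    then have "(\<Sum>k\<in>I. \<bar>x k - T L x k\<bar>) \<le> (\<Sum>k\<in>I. (x k)\<^sup>2 / L)"
      by (rule sum_mono)
    then have "K' * (\<Sum>k\<in>I. \<bar>x k - T L x k\<bar>) \<le> K' * (\<Sum>k\<in>I. (x k)\<^sup>2 / L)"
      by (rule mult_left_mono) (simp add: K'_def)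
    moreover have "K * (\<Sum>k\<in>I. \<bar>x k - T L x k\<bar>) \<le> K' * (\<Sum>k\<in>I. \<bar>x k - T L x k\<bar>)"
      by (intro mult_right_mono sum_nonneg) (auto simp: K'_def)
    ultimately show ?thesis
      using lip[of x "T L x"] by (simp add: sum_divide_distrib[symmetric])
  qed
  show ?thesis
  proof (rule LIMSEQ_uniform_approx)
    fix e :: real assume "e > 0"
    \<comment> \<open>The sine replacement costs at most \<open>D / L\<close> in expectation, by the
      second moment bound. \<open>L\<close> is chosen to make this at most \<open>e\<close>; the
      added 1 keeps \<open>L\<close> positive when \<open>D = 0\<close>.\<close>
    define D where "D = K' * (real (card I) * \<bar>B\<bar>)"
    have "D \<ge> 0" by (simp add: D_def K'_def)
    define L where "L = (D + 1) / e"
    have "L > 0" using \<open>D \<ge> 0\<close> \<open>e > 0\<close> by (simp add: L_def)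
    have DL: "D / L \<le> e"
      using \<open>D \<ge> 0\<close> \<open>e > 0\<close> by (simp add: L_def field_simps)
    have bound: "K' / L * (\<Sum>k\<in>I. b k) \<le> e" if "\<And>k. k \<in> I \<Longrightarrow> b k \<le> B" for b
    proof -
      have "(\<Sum>k\<in>I. b k) \<le> (\<Sum>k\<in>I. \<bar>B\<bar>)"
        using that by (intro sum_mono) force
      then have "K' / L * (\<Sum>k\<in>I. b k) \<le> K' / L * (real (card I) * \<bar>B\<bar>)"
        using \<open>L > 0\<close> by (intro mult_left_mono) (auto simp: K'_def)
      then show ?thesis using DL by (simp add: D_def)
    qed
    have "\<bar>(\<integral>\<omega>. f (V n \<omega>) \<partial>M) - (\<integral>\<omega>. f (T L (V n \<omega>)) \<partial>M)\<bar>
        \<le> (\<integral>\<omega>. K' / L * (\<Sum>k\<in>I. (V n \<omega> k)\<^sup>2) \<partial>M)" for n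
      by (intro integral_diff_bound intTV intV close[OF \<open>L > 0\<close>] integrable_mult_right
            Bochner_Integration.integrable_sum V2)
    moreover have "(\<integral>\<omega>. K' / L * (\<Sum>k\<in>I. (V n \<omega> k)\<^sup>2) \<partial>M) \<le> e" for n
      using bound[of "\<lambda>k. \<integral>\<omega>. (V n \<omega> k)\<^sup>2 \<partial>M"] V2 by (simp add: integral_sum)
    moreover have "\<bar>(\<integral>\<omega>. f (G \<omega>) \<partial>N) - (\<integral>\<omega>. f (T L (G \<omega>)) \<partial>N)\<bar>
        \<le> (\<integral>\<omega>. K' / L * (\<Sum>k\<in>I. (G \<omega> k)\<^sup>2) \<partial>N)"
      by (intro integral_diff_bound intTG intG close[OF \<open>L > 0\<close>] integrable_mult_right
            Bochner_Integration.integrable_sum G2)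
    moreover have "(\<integral>\<omega>. K' / L * (\<Sum>k\<in>I. (G \<omega> k)\<^sup>2) \<partial>N) \<le> e"
      using bound[of "\<lambda>k. \<integral>\<omega>. (G \<omega> k)\<^sup>2 \<partial>N"] G2 by (simp add: integral_sum)
    ultimately show "\<exists>b b'. b \<longlonglongrightarrow> b' \<and> (\<forall>n. \<bar>(\<integral>\<omega>. f (V n \<omega>) \<partial>M) - b n\<bar> \<le> e)
        \<and> \<bar>(\<integral>\<omega>. f (G \<omega>) \<partial>N) - b'\<bar> \<le> e"
      using stepA[OF \<open>L > 0\<close>] by (meson order_trans)
  qed
qed

section \<open>Projection onto the cone\<close>

lemma K0_add: "g \<in> K0 p0 S \<Longrightarrow> h \<in> K0 p0 S \<Longrightarrow> (\<lambda>k. g k + h k) \<in> K0 p0 S"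
  by (force simp: K0_def Delta2_def)

lemma K0_scale: "g \<in> K0 p0 S \<Longrightarrow> a \<ge> 0 \<Longrightarrow> (\<lambda>k. a * g k) \<in> K0 p0 S"
proof -
  assume g: "g \<in> K0 p0 S" and a: "a \<ge> 0"
  have "Delta2 (\<lambda>k. a * g k) k = a * Delta2 g k" for k
    by (simp add: Delta2_def algebra_simps)
  with g a show ?thesis by (auto simp: K0_def)
qed

lemma K0_zero: "(\<lambda>_. 0) \<in> K0 p0 S"
  by (simp add: K0_def Delta2_def)

text \<open>The constraints at \<open>k \<le> S\<close> reach only up to index \<open>S + 1\<close>,
  so they do not see the cutoff; \<open>t\<close> may have either sign.\<close>

lemma K0_const: "(\<lambda>k. if k \<le> S + 1 then t else 0) \<in> K0 p0 S"
  by (auto simp: K0_def Delta2_def)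

text \<open>Only the constraint at \<open>S\<close> involves index \<open>S + 1\<close>, with
  coefficient 1.\<close>

lemma K0_last: "t \<ge> 0 \<Longrightarrow> (\<lambda>k. if k = S + 1 then t else 0) \<in> K0 p0 S"
  by (auto simp: K0_def Delta2_def)

lemma closed_K0: "closed (K0 p0 S)"
proof -
  have eq: "K0 p0 S = (\<Inter>k\<in>{S+1<..}. {g. g k = 0}) \<inter>
      (\<Inter>k\<in>{k\<in>{1..S}. \<not> knot p0 k}. {g. 0 \<le> g (k + 1) - 2 * g k + g (k - 1)})"
    by (auto simp: K0_def Delta2_def)
  show ?thesis
    unfolding eq
    by (intro closed_Int closed_INT ballI closed_Collect_eq closed_Collect_le continuous_intros
        continuous_on_product_coordinates)
qed

lemma K0_minimizer_exists:
  "\<exists>g\<in>K0 p0 S. \<forall>g'\<in>K0 p0 S. (\<Sum>k=0..S+1. (g k - x k)\<^sup>2) \<le> (\<Sum>k=0..S+1. (g' k - x k)\<^sup>2)"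
proof -
  define F where "F g = (\<Sum>k=0..S+1. (g k - x k)\<^sup>2)" for g :: "nat \<Rightarrow> real"
  \<comment> \<open>A competitor \<open>h\<close> at least as good as 0 satisfies
    \<open>\<bar>h k - x k\<bar> \<le> sqrt (F 0)\<close>, hence
    \<open>\<bar>h k\<bar> \<le> R\<close>. Minimizing over the compact box therefore
    suffices.\<close>
  define R where "R = sqrt (F (\<lambda>_. 0)) + (\<Sum>k=0..S+1. \<bar>x k\<bar>)"
  define Q where "Q = {g. \<forall>k. g k \<in> (if k \<le> S + 1 then {-R..R} else {0})}"
  have "F (\<lambda>_. 0) \<ge> 0" by (simp add: F_def sum_nonneg)
  then have "R \<ge> 0" by (simp add: R_def sum_nonneg add_nonneg_nonneg)
  have "compact (Q \<inter> K0 p0 S)"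
    unfolding Q_def by (intro compact_Int_closed compact_coordinatewise closed_K0) auto
  moreover have "(\<lambda>_. 0) \<in> Q \<inter> K0 p0 S"
    using \<open>R \<ge> 0\<close> by (auto simp: Q_def K0_zero)
  moreover have "continuous_on (Q \<inter> K0 p0 S) F"
    unfolding F_def by (intro continuous_intros continuous_on_subset[OF continuous_on_product_coordinates]) auto
  ultimately obtain g where g: "g \<in> Q \<inter> K0 p0 S" "\<And>h. h \<in> Q \<inter> K0 p0 S \<Longrightarrow> F g \<le> F h"
    using continuous_attains_inf[of "Q \<inter> K0 p0 S" F] by blast
  have "F g \<le> F h" if h: "h \<in> K0 p0 S" for h
  proof (cases "F h \<le> F (\<lambda>_. 0)")
    case True
    have "\<bar>h k\<bar> \<le> R" if k: "k \<le> S + 1" for k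
    proof -
      have "(h k - x k)\<^sup>2 \<le> F h"
        unfolding F_def using k by (intro member_le_sum) auto
      with True have "\<bar>h k - x k\<bar> \<le> sqrt (F (\<lambda>_. 0))"
        by (metis order_trans real_sqrt_abs real_sqrt_le_iff)
      moreover have "\<bar>x k\<bar> \<le> (\<Sum>k=0..S+1. \<bar>x k\<bar>)"
        using k by (intro member_le_sum) auto
      ultimately show ?thesis unfolding R_def by linarith
    qed
    then have "h \<in> Q" using h by (force simp: Q_def K0_def)
    with h g(2) show ?thesis by blast
  next
    case False
    with g(2)[OF \<open>(\<lambda>_. 0) \<in> Q \<inter> K0 p0 S\<close>] show ?thesis by simp
  qed
  with g(1) show ?thesis unfolding F_def by blast
qed

text \<open>Parallelogram identity: the midpoint of two minimizers lies in the cone and would be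
  strictly better unless they coincide.\<close>

lemma K0_minimizer_unique:
  assumes g: "g \<in> K0 p0 S" "\<And>g'. g' \<in> K0 p0 S \<Longrightarrow> (\<Sum>k=0..S+1. (g k - x k)\<^sup>2) \<le> (\<Sum>k=0..S+1. (g' k - x k)\<^sup>2)"
    and h: "h \<in> K0 p0 S" "\<And>g'. g' \<in> K0 p0 S \<Longrightarrow> (\<Sum>k=0..S+1. (h k - x k)\<^sup>2) \<le> (\<Sum>k=0..S+1. (g' k - x k)\<^sup>2)"
  shows "g = h"
proof
  fix k
  define m where "m = (\<lambda>k. 1/2 * (g k + h k))"
  have m: "m \<in> K0 p0 S"
    unfolding m_def using K0_scale[OF K0_add[OF g(1) h(1)], of "1/2"] by simp
  have "(\<Sum>k=0..S+1. (m k - x k)\<^sup>2) =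
      (\<Sum>k=0..S+1. 1/2 * (g k - x k)\<^sup>2 + 1/2 * (h k - x k)\<^sup>2 - 1/4 * (g k - h k)\<^sup>2)"
    by (intro sum.cong refl) (simp add: m_def power2_eq_square field_simps)
  also have "\<dots> = 1/2 * (\<Sum>k=0..S+1. (g k - x k)\<^sup>2) + 1/2 * (\<Sum>k=0..S+1. (h k - x k)\<^sup>2)
      - 1/4 * (\<Sum>k=0..S+1. (g k - h k)\<^sup>2)"
    by (simp only: sum.distrib sum_subtractf sum_distrib_left)
  finally have "(\<Sum>k=0..S+1. (g k - h k)\<^sup>2) \<le> 0"
    using g(2)[OF m] h(2)[OF m] by linarith
  then have "(\<Sum>k=0..S+1. (g k - h k)\<^sup>2) = 0"
    by (intro antisym sum_nonneg) auto
  then have "\<forall>k\<in>{0..S+1}. g k = h k"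
    by (subst (asm) sum_nonneg_eq_0_iff) auto
  moreover have "k > S + 1 \<Longrightarrow> g k = h k"
    using g(1) h(1) by (simp add: K0_def)
  ultimately show "g k = h k" by force
qed

text \<open>Existence and uniqueness give meaning to the definite description in
  \<open>proj_K0\<close>. From here on \<open>T0_hat\<close> can be read as the squared Euclidean
  distance to the cone.\<close>

lemma
  shows proj_K0_in: "proj_K0 p0 S x \<in> K0 p0 S"
    and T0_hat_le: "g \<in> K0 p0 S \<Longrightarrow> T0_hat p0 S x \<le> (\<Sum>k=0..S+1. (g k - x k)\<^sup>2)"
proof -
  let ?P = "\<lambda>g. g \<in> K0 p0 S \<and> (\<forall>g'\<in>K0 p0 S. (\<Sum>k=0..S+1. (g k - x k)\<^sup>2) \<le> (\<Sum>k=0..S+1. (g' k - x k)\<^sup>2))"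
  have "\<exists>!g. ?P g"
  proof (rule ex_ex1I)
    show "\<exists>g. ?P g" using K0_minimizer_exists[of p0 S x] by blast
    show "g = h" if "?P g" "?P h" for g h
      by (rule K0_minimizer_unique[where x = x]) (use that in blast)+
  qed
  from theI'[OF this] have "?P (proj_K0 p0 S x)"
    unfolding proj_K0_def .
  then show "proj_K0 p0 S x \<in> K0 p0 S"
    "g \<in> K0 p0 S \<Longrightarrow> T0_hat p0 S x \<le> (\<Sum>k=0..S+1. (g k - x k)\<^sup>2)"
    unfolding T0_hat_def by blast+
qed

lemma T0_hat_nonneg: "T0_hat p0 S x \<ge> 0"
  by (simp add: T0_hat_def sum_nonneg)

lemma proj_K0_unique:
  assumes "g \<in> K0 p0 S" "(\<Sum>k=0..S+1. (g k - x k)\<^sup>2) \<le> T0_hat p0 S x"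
  shows "g = proj_K0 p0 S x"
  by (rule K0_minimizer_unique[where x = x])
    (use assms T0_hat_le proj_K0_in in \<open>fastforce simp: T0_hat_def intro: order_trans\<close>)+

text \<open>Scaling the projection of \<open>x\<close> gives a competitor for the scaled vector;
  applying the resulting inequality to \<open>a\<close> and to \<open>1 / a\<close> yields
  equality.\<close>

lemma T0_hat_scale:
  assumes "a > 0"
  shows "T0_hat p0 S (\<lambda>k. a * x k) = a\<^sup>2 * T0_hat p0 S x"
proof -
  have le: "T0_hat p0 S (\<lambda>k. b * y k) \<le> b\<^sup>2 * T0_hat p0 S y" if "b > 0" for b y
  proof -
    have "T0_hat p0 S (\<lambda>k. b * y k) \<le> (\<Sum>k=0..S+1. (b * proj_K0 p0 S y k - b * y k)\<^sup>2)"
      using that by (intro T0_hat_le K0_scale proj_K0_in) auto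
    also have "\<dots> = b\<^sup>2 * T0_hat p0 S y"
      by (simp only: T0_hat_def sum_distrib_left power_mult_distrib right_diff_distrib[symmetric])
    finally show ?thesis .
  qed
  have "T0_hat p0 S (\<lambda>k. (1 / a) * (a * x k)) \<le> (1 / a)\<^sup>2 * T0_hat p0 S (\<lambda>k. a * x k)"
    using assms by (intro le) auto
  then have "a\<^sup>2 * T0_hat p0 S x \<le> T0_hat p0 S (\<lambda>k. a * x k)"
    using assms by (simp add: field_simps power2_eq_square)
  with le[OF assms, of x] show ?thesis by (rule antisym)
qed

text \<open>The distance to a set is 1-Lipschitz in the Euclidean norm, which the sum of absolute
  values dominates. The root is essential: the squared distance is not globally Lipschitz in
  general.\<close>

lemma sqrt_T0_hat_lipschitz:
  "\<bar>sqrt (T0_hat p0 S x) - sqrt (T0_hat p0 S y)\<bar> \<le> (\<Sum>k\<in>{0..S+1}. \<bar>x k - y k\<bar>)"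
proof -
  have le: "sqrt (T0_hat p0 S x) \<le> sqrt (T0_hat p0 S y) + (\<Sum>k\<in>{0..S+1}. \<bar>x k - y k\<bar>)" for x y
  proof -
    have "sqrt (T0_hat p0 S x) \<le> L2_set (\<lambda>k. proj_K0 p0 S y k - x k) {0..S+1}"
      unfolding L2_set_def by (intro real_sqrt_le_mono T0_hat_le proj_K0_in)
    also have "\<dots> = L2_set (\<lambda>k. (proj_K0 p0 S y k - y k) + (y k - x k)) {0..S+1}"
      by simp
    also have "\<dots> \<le> L2_set (\<lambda>k. proj_K0 p0 S y k - y k) {0..S+1} + L2_set (\<lambda>k. y k - x k) {0..S+1}"
      by (rule L2_set_triangle_ineq)
    also have "\<dots> \<le> sqrt (T0_hat p0 S y) + (\<Sum>k\<in>{0..S+1}. \<bar>y k - x k\<bar>)"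
      using L2_set_le_sum_abs[of "\<lambda>k. y k - x k" "{0..S+1}"] by (simp add: L2_set_def T0_hat_def)
    finally show ?thesis by (simp only: abs_minus_commute)
  qed
  have "(\<Sum>k\<in>{0..S+1}. \<bar>x k - y k\<bar>) = (\<Sum>k\<in>{0..S+1}. \<bar>y k - x k\<bar>)"
    by (simp only: abs_minus_commute)
  with le[of x y] le[of y x] show ?thesis by linarith
qed

section \<open>First-order optimality of the projection and its consequences\<close>

lemma linear_coeff_nonneg_if_quadratic_nonneg:
  fixes a b :: real
  assumes "\<And>t. 0 \<le> t \<Longrightarrow> 0 \<le> t * a + t\<^sup>2 * b"
  shows "a \<ge> 0"
proof (rule ccontr)
  assume "\<not> 0 \<le> a"
  \<comment> \<open>Chosen so that \<open>t * (\<bar>b\<bar> + 1) = - a / 2\<close>: the quadratic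
    term then cancels at most half of the negative linear one.\<close>
  define t where "t = - a / (2 * (\<bar>b\<bar> + 1))"
  have t: "t > 0" using \<open>\<not> 0 \<le> a\<close> unfolding t_def by (intro divide_pos_pos) auto
  have "t * b \<le> t * (\<bar>b\<bar> + 1)"
    using t by (intro mult_left_mono) auto
  also have "\<dots> = - a / 2" by (simp add: t_def field_simps)
  finally have "a + t * b < 0" using \<open>\<not> 0 \<le> a\<close> by simp
  with t have "t * (a + t * b) < 0" by (simp add: mult_less_0_iff)
  with assms[of t] t show False by (simp add: power2_eq_square algebra_simps)
qed

text \<open>Moving from the projection along \<open>h\<close> stays in the cone, so the squared
  distance, a quadratic in the step length, cannot initially decrease.\<close>

lemma proj_K0_variational:
  assumes "h \<in> K0 p0 S"
  shows "0 \<le> (\<Sum>k=0..S+1. (proj_K0 p0 S x k - x k) * h k)"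
proof -
  let ?g = "proj_K0 p0 S x"
  have "0 \<le> t * (2 * (\<Sum>k=0..S+1. (?g k - x k) * h k)) + t\<^sup>2 * (\<Sum>k=0..S+1. (h k)\<^sup>2)" if "t \<ge> 0" for t
  proof -
    have "T0_hat p0 S x \<le> (\<Sum>k=0..S+1. ((?g k + t * h k) - x k)\<^sup>2)"
      using that assms by (intro T0_hat_le K0_add K0_scale proj_K0_in)
    also have "\<dots> = (\<Sum>k=0..S+1. (?g k - x k)\<^sup>2 + t * (2 * ((?g k - x k) * h k)) + t\<^sup>2 * (h k)\<^sup>2)"
      by (intro sum.cong refl) (simp add: power2_eq_square algebra_simps)
    also have "\<dots> = T0_hat p0 S x + t * (2 * (\<Sum>k=0..S+1. (?g k - x k) * h k)) + t\<^sup>2 * (\<Sum>k=0..S+1. (h k)\<^sup>2)"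
      by (simp only: sum.distrib sum_distrib_left T0_hat_def)
    finally show ?thesis by simp
  qed
  from linear_coeff_nonneg_if_quadratic_nonneg[OF this] show ?thesis by simp
qed

text \<open>Testing the variational inequality with the constants 1 and -1 makes the residual sum to
  zero. This preserves total mass.\<close>

lemma sum_proj_K0: "(\<Sum>k=0..S+1. proj_K0 p0 S x k) = (\<Sum>k=0..S+1. x k)"
proof -
  have "0 \<le> t * (\<Sum>k=0..S+1. proj_K0 p0 S x k - x k)" for t
    using proj_K0_variational[OF K0_const[of S t p0], of x]
    by (simp add: sum_distrib_left mult.commute del: sum.cl_ivl_Suc)
  from this[of 1] this[of "-1"] show ?thesis
    by (simp add: sum_subtractf del: sum.cl_ivl_Suc)
qed

text \<open>Test direction: the indicator of \<open>S + 1\<close>. It secures nonnegativity at the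
  one index of the window where \<open>p0\<close> vanishes.\<close>

lemma proj_K0_last: "x (S + 1) \<le> proj_K0 p0 S x (S + 1)"
  using proj_K0_variational[OF K0_last[of 1 S p0], of x] by simp

text \<open>Since 0 lies in the cone, the residual is no longer than \<open>x\<close>; the triangle
  inequality adds the second copy of the norm.\<close>

lemma abs_proj_K0_le:
  assumes "k \<le> S + 1"
  shows "\<bar>proj_K0 p0 S x k\<bar> \<le> 2 * (\<Sum>k=0..S+1. \<bar>x k\<bar>)"
proof -
  have "\<bar>proj_K0 p0 S x k - x k\<bar> \<le> L2_set (\<lambda>k. \<bar>proj_K0 p0 S x k - x k\<bar>) {0..S+1}"
    using assms by (intro member_le_L2_set) auto
  also have "\<dots> \<le> L2_set (\<lambda>k. 0 - x k) {0..S+1}"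
    using T0_hat_le[OF K0_zero, of p0 S x] unfolding L2_set_def T0_hat_def by simp
  also have "\<dots> \<le> (\<Sum>k=0..S+1. \<bar>x k\<bar>)"
    using L2_set_le_sum_abs[of "\<lambda>k. 0 - x k" "{0..S+1}"] by simp
  moreover have "\<bar>x k\<bar> \<le> (\<Sum>k=0..S+1. \<bar>x k\<bar>)"
    using assms by (intro member_le_sum) auto
  ultimately show ?thesis by linarith
qed

section \<open>The least-squares projection of a sequence close to \<open>p0\<close>\<close>

lemma is_pmf_square_summable:
  assumes "is_pmf p"
  shows "(\<lambda>j. (p j)\<^sup>2) summable_on UNIV"
proof -
  have p: "p summable_on UNIV" "\<And>j. p j \<ge> 0" "(p has_sum 1) UNIV"
    using assms by (auto simp: is_pmf_def summable_on_def)
  have le1: "p j \<le> 1" for j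
  proof -
    have "(p has_sum p j) {j}" using has_sum_finite[of "{j}" p] by simp
    from has_sum_mono_neutral[OF this p(3)] p(2) show ?thesis by simp
  qed
  show ?thesis
    by (rule summable_on_comparison_test[OF p(1)])
      (use p(2) le1 in \<open>auto simp: power2_eq_square intro: mult_left_le\<close>)
qed

lemma ls_proj_eqI:
  assumes "p \<in> convex_pmfs"
    and "\<And>p'. p' \<in> convex_pmfs \<Longrightarrow> sqnorm (\<lambda>j. q j - p j) \<le> sqnorm (\<lambda>j. q j - p' j)"
    and "\<And>p'. p' \<in> convex_pmfs \<Longrightarrow> sqnorm (\<lambda>j. q j - p' j) \<le> sqnorm (\<lambda>j. q j - p j) \<Longrightarrow> p' = p"
  shows "ls_proj q = p"
  unfolding ls_proj_def
  by (rule the_equality) (use assms in auto)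

text \<open>A competing pmf may charge all of the naturals. Its mass beyond \<open>S + 1\<close>
  enters as a pure penalty, separate from the finite-dimensional problem.\<close>

lemma sqnorm_split:
  assumes q: "\<And>j. j > S + 1 \<Longrightarrow> q j = 0" and p: "is_pmf p"
  shows "sqnorm (\<lambda>j. q j - p j) = (\<Sum>j=0..S+1. (q j - p j)\<^sup>2) + (\<Sum>\<^sub>\<infinity>j\<in>{S+1<..}. (p j)\<^sup>2)"
proof -
  have tail: "(\<lambda>j. (p j)\<^sup>2) summable_on {S+1<..}"
    using is_pmf_square_summable[OF p] by (rule summable_on_subset_banach) auto
  have "sqnorm (\<lambda>j. q j - p j) = (\<Sum>\<^sub>\<infinity>j\<in>{0..S+1} \<union> {S+1<..}. (q j - p j)\<^sup>2)"
    unfolding sqnorm_def by (intro infsum_cong_neutral) auto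
  also have "\<dots> = (\<Sum>\<^sub>\<infinity>j\<in>{0..S+1}. (q j - p j)\<^sup>2) + (\<Sum>\<^sub>\<infinity>j\<in>{S+1<..}. (q j - p j)\<^sup>2)"
  proof (rule infsum_Un_disjoint)
    show "(\<lambda>j. (q j - p j)\<^sup>2) summable_on {S+1<..}"
      using tail by (rule summable_on_cong[THEN iffD1, rotated]) (use q in auto)
  qed auto
  also have "(\<Sum>\<^sub>\<infinity>j\<in>{S+1<..}. (q j - p j)\<^sup>2) = (\<Sum>\<^sub>\<infinity>j\<in>{S+1<..}. (p j)\<^sup>2)"
    by (intro infsum_cong) (use q in auto)
  finally show ?thesis by simp
qed

lemma ls_proj_near:
  assumes "is_pmf p0" and supp: "\<And>j. p0 j > 0 \<longleftrightarrow> j \<le> S" and conv: "convex_seq p0"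
  obtains \<delta> where "\<delta> > 0"
    "\<And>q. (\<And>j. j \<le> S + 1 \<Longrightarrow> \<bar>q j - p0 j\<bar> \<le> \<delta>) \<Longrightarrow> (\<And>j. j > S \<Longrightarrow> q j = 0) \<Longrightarrow> (\<Sum>j=0..S+1. q j) = 1 \<Longrightarrow>
      sqnorm (\<lambda>j. q j - ls_proj q j) = T0_hat p0 S (\<lambda>j. q j - p0 j)"
proof -
  have p0_0: "p0 j = 0" if "j > S" for j
    using assms(1) supp[of j] that by (auto simp: is_pmf_def not_le less_le)
  have p0_sum: "(\<Sum>j=0..S+1. p0 j) = 1"
  proof -
    have "(p0 has_sum (\<Sum>j=0..S+1. p0 j)) UNIV"
      by (rule has_sum_finite_neutralI[of "{0..S+1}"]) (use p0_0 in auto)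
    moreover have "(p0 has_sum 1) UNIV" using assms(1) by (simp add: is_pmf_def)
    ultimately show ?thesis by (rule has_sum_unique)
  qed
  \<comment> \<open>\<open>A\<close> collects the strict inequalities that a perturbation of
    \<open>p0\<close> must preserve: positive masses on the support and positive second differences
    at the knots. Its minimum \<open>m\<close> is the available slack.\<close>
  define A where "A = insert 1 (p0 ` {..S} \<union> Delta2 p0 ` {k\<in>{..S+1}. knot p0 k})"
  define m where "m = Min A"
  have A: "finite A" "A \<noteq> {}" "\<And>a. a \<in> A \<Longrightarrow> a > 0"
    using supp by (auto simp: A_def knot_def)
  then have "m > 0" and m_le: "\<And>a. a \<in> A \<Longrightarrow> m \<le> a"
    by (auto simp: m_def)
  \<comment> \<open>With \<open>S + 2\<close> coordinates the perturbation has absolute sum at most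
    \<open>m / 8\<close>, so the projection is bounded by \<open>m / 4\<close>. A second difference
    has coefficients of total size 4 and thus changes by at most \<open>m\<close>.\<close>
  define \<delta> where "\<delta> = m / (8 * (real S + 2))"
  have "\<delta> > 0" using \<open>m > 0\<close> by (simp add: \<delta>_def)
  moreover have "sqnorm (\<lambda>j. q j - ls_proj q j) = T0_hat p0 S (\<lambda>j. q j - p0 j)"
    if near: "\<And>j. j \<le> S + 1 \<Longrightarrow> \<bar>q j - p0 j\<bar> \<le> \<delta>" and q0: "\<And>j. j > S \<Longrightarrow> q j = 0"
      and q_sum: "(\<Sum>j=0..S+1. q j) = 1" for q
  proof -
    define x where "x = (\<lambda>j. q j - p0 j)"
    define g where "g = proj_K0 p0 S x"
    define p where "p j = p0 j + g j" for j
    have gK: "g \<in> K0 p0 S" by (simp add: g_def proj_K0_in)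
    then have g0: "g j = 0" if "j > S + 1" for j using that by (simp add: K0_def)
    have "(\<Sum>k=0..S+1. \<bar>x k\<bar>) \<le> (\<Sum>k=0..S+1. \<delta>)"
      using near by (intro sum_mono) (auto simp: x_def)
    also have "\<dots> = m / 8"
      by (simp add: \<delta>_def add_divide_distrib[symmetric] del: sum.cl_ivl_Suc) (simp add: field_simps)
    finally have g_le: "\<bar>g j\<bar> \<le> m / 4" for j
      using abs_proj_K0_le[of j S p0 x] g0[of j] \<open>m > 0\<close>
      unfolding g_def[symmetric] by (cases "j \<le> S + 1") auto
    have g_last: "0 \<le> g (S + 1)"
      using proj_K0_last[of x S p0] q0 p0_0 by (simp add: g_def x_def)
    have p_nonneg: "p j \<ge> 0" for j
    proof -
      consider "j \<le> S" | "j = S + 1" | "j > S + 1" by linarith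
      then show ?thesis
      proof cases
        case 1
        then have "m \<le> p0 j" by (intro m_le) (auto simp: A_def)
        with g_le[of j] \<open>m > 0\<close> show ?thesis by (simp add: p_def)
      next
        case 2
        then show ?thesis using g_last p0_0[of j] by (simp add: p_def)
      next
        case 3
        then show ?thesis using p0_0[of j] g0[of j] by (simp add: p_def)
      qed
    qed
    have Delta_p: "Delta2 p k = Delta2 p0 k + Delta2 g k" for k
      by (simp add: Delta2_def p_def)
    have "Delta2 p k \<ge> 0" if "k \<ge> 1" for k
    proof -
      have *: "Delta2 p k \<ge> 0" if "knot p0 k" "k \<le> S + 1"
      proof -
        have "m \<le> Delta2 p0 k" using that by (intro m_le) (auto simp: A_def)
        moreover have "Delta2 g k \<ge> - m"
          using g_le[of k] g_le[of "k + 1"] g_le[of "k - 1"] unfolding Delta2_def by linarith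
        ultimately show ?thesis by (simp add: Delta_p)
      qed
      consider "k \<le> S" "\<not> knot p0 k" | "k \<le> S" "knot p0 k" | "k = S + 1" | "k \<ge> S + 2" by linarith
      then show ?thesis
      proof cases
        case 1
        with gK \<open>k \<ge> 1\<close> have "Delta2 g k \<ge> 0" by (simp add: K0_def)
        moreover have "Delta2 p0 k \<ge> 0" using conv \<open>k \<ge> 1\<close> by (simp add: convex_seq_def)
        ultimately show ?thesis by (simp add: Delta_p)
      next
        case 2
        then show ?thesis using * by simp
      next
        case 3
        \<comment> \<open>\<open>S + 1\<close> is always a knot: the second difference of
          \<open>p0\<close> there equals \<open>p0 S\<close>, which is positive. The cone has no
          constraint at this index, so the slack must cover it.\<close>
        then have "knot p0 k"
          using p0_0[of "S + 1"] p0_0[of "S + 2"] supp[of S] by (simp add: knot_def Delta2_def)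
        with * 3 show ?thesis by simp
      next
        case 4
        \<comment> \<open>Only \<open>p (k - 1)\<close> survives in the second difference; it can be
          nonzero when \<open>k = S + 2\<close>, but it is nonnegative.\<close>
        then have "p k = 0" "p (k + 1) = 0" using p0_0 g0 by (simp_all add: p_def)
        then show ?thesis using p_nonneg[of "k - 1"] by (simp add: Delta2_def)
      qed
    qed
    then have "convex_seq p" by (simp add: convex_seq_def)
    moreover have "is_pmf p"
    proof -
      have "(\<Sum>j=0..S+1. g j) = 0"
        unfolding g_def sum_proj_K0 x_def sum_subtractf p0_sum q_sum by simp
      then have "(\<Sum>j=0..S+1. p j) = 1"
        unfolding p_def sum.distrib p0_sum by simp
      moreover have "(p has_sum (\<Sum>j=0..S+1. p j)) UNIV"
        by (rule has_sum_finite_neutralI[of "{0..S+1}"]) (use p0_0 g0 in \<open>auto simp: p_def\<close>)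
      ultimately show ?thesis using p_nonneg by (simp add: is_pmf_def)
    qed
    ultimately have p_cp: "p \<in> convex_pmfs" by (simp add: convex_pmfs_def)
    have q0': "q j = 0" if "j > S + 1" for j using q0 that by simp
    have tail: "(\<Sum>\<^sub>\<infinity>j\<in>{S+1<..}. (p j)\<^sup>2) = 0"
      by (intro infsum_0) (use p0_0 g0 in \<open>auto simp: p_def\<close>)
    have sq_p: "sqnorm (\<lambda>j. q j - p j) = T0_hat p0 S x"
    proof -
      have "sqnorm (\<lambda>j. q j - p j) = (\<Sum>j=0..S+1. (q j - p j)\<^sup>2)"
        using sqnorm_split[OF q0' \<open>is_pmf p\<close>] tail by simp
      also have "\<dots> = (\<Sum>j=0..S+1. (g j - x j)\<^sup>2)"
        by (intro sum.cong refl) (simp add: x_def p_def power2_eq_square algebra_simps)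
      finally show ?thesis by (simp add: T0_hat_def g_def)
    qed
    \<comment> \<open>Every competitor yields an element \<open>h\<close> of the cone, because the
      second difference of \<open>p0\<close> is not positive off the knots. Its cost is the cone
      objective at \<open>h\<close> plus a nonnegative tail.\<close>
    have other: "sqnorm (\<lambda>j. q j - p' j) =
        (\<Sum>k=0..S+1. (h k - x k)\<^sup>2) + (\<Sum>\<^sub>\<infinity>j\<in>{S+1<..}. (p' j)\<^sup>2)"
      "h \<in> K0 p0 S" "(\<Sum>\<^sub>\<infinity>j\<in>{S+1<..}. (p' j)\<^sup>2) \<ge> 0"
      if p': "p' \<in> convex_pmfs" and h: "h = (\<lambda>k. if k \<le> S + 1 then p' k - p0 k else 0)" for p' h
    proof -
      have "is_pmf p'" "convex_seq p'" using p' by (auto simp: convex_pmfs_def)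
      show "sqnorm (\<lambda>j. q j - p' j) = (\<Sum>k=0..S+1. (h k - x k)\<^sup>2) + (\<Sum>\<^sub>\<infinity>j\<in>{S+1<..}. (p' j)\<^sup>2)"
      proof -
        have "sqnorm (\<lambda>j. q j - p' j) = (\<Sum>k=0..S+1. (q k - p' k)\<^sup>2) + (\<Sum>\<^sub>\<infinity>j\<in>{S+1<..}. (p' j)\<^sup>2)"
          by (rule sqnorm_split) (use q0' \<open>is_pmf p'\<close> in auto)
        also have "(\<Sum>k=0..S+1. (q k - p' k)\<^sup>2) = (\<Sum>k=0..S+1. (h k - x k)\<^sup>2)"
          by (intro sum.cong) (auto simp: h x_def power2_eq_square algebra_simps)
        finally show ?thesis .
      qed
      have "Delta2 h k \<ge> 0" if "k \<in> {1..S}" "\<not> knot p0 k" for k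
      proof -
        have "Delta2 p0 k \<le> 0" using that by (auto simp: knot_def)
        moreover have "Delta2 p' k \<ge> 0" using \<open>convex_seq p'\<close> that by (simp add: convex_seq_def)
        moreover have "Delta2 h k = Delta2 p' k - Delta2 p0 k" using that by (auto simp: Delta2_def h)
        ultimately show ?thesis by simp
      qed
      then show "h \<in> K0 p0 S" by (auto simp: K0_def h)
      show "(\<Sum>\<^sub>\<infinity>j\<in>{S+1<..}. (p' j)\<^sup>2) \<ge> 0" by (intro infsum_nonneg) auto
    qed
    have "ls_proj q = p"
    proof (rule ls_proj_eqI[OF p_cp])
      fix p' assume p': "p' \<in> convex_pmfs"
      define h where "h = (\<lambda>k. if k \<le> S + 1 then p' k - p0 k else 0)"
      note o = other[OF p' h_def]
      show "sqnorm (\<lambda>j. q j - p j) \<le> sqnorm (\<lambda>j. q j - p' j)"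
        unfolding sq_p using o T0_hat_le[OF o(2), of x] by simp
      \<comment> \<open>A competitor that does as well must attain the cone minimum and have zero
        tail, so it equals \<open>p\<close> both on the window and beyond it.\<close>
      assume le: "sqnorm (\<lambda>j. q j - p' j) \<le> sqnorm (\<lambda>j. q j - p j)"
      then have "(\<Sum>k=0..S+1. (h k - x k)\<^sup>2) \<le> T0_hat p0 S x"
        unfolding sq_p using o by simp
      then have "h = g" unfolding g_def by (rule proj_K0_unique[OF o(2)])
      have "(\<Sum>\<^sub>\<infinity>j\<in>{S+1<..}. (p' j)\<^sup>2) = 0"
        using le o T0_hat_le[OF o(2), of x] unfolding sq_p by simp
      moreover have "(\<lambda>j. (p' j)\<^sup>2) summable_on {S+1<..}"
        using p' by (intro summable_on_subset_banach[OF is_pmf_square_summable]) (auto simp: convex_pmfs_def)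
      ultimately have "(p' j)\<^sup>2 = 0" if "j > S + 1" for j
        using that by (intro nonneg_infsum_le_0D[of "\<lambda>j. (p' j)\<^sup>2" "{S+1<..}"]) auto
      then have tail': "p' j = p j" if "j > S + 1" for j
        using that p0_0[of j] g0[of j] by (simp add: p_def)
      have "p' j = p j" if "j \<le> S + 1" for j
        using that fun_cong[OF \<open>h = g\<close>, of j] by (simp add: h_def p_def)
      with tail' show "p' = p" by (intro ext) (meson not_le)
    qed
    then show ?thesis using sq_p by (simp add: x_def)
  qed
  ultimately show ?thesis using that by blast
qed

section \<open>Weak convergence and Gaussian variables\<close>

lemma char_distr:
  "Y \<in> borel_measurable M \<Longrightarrow> char (distr M borel Y) t = (\<integral>\<omega>. iexp (t * Y \<omega>) \<partial>M)"
  unfolding char_def by (rule integral_distr) auto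

lemma (in prob_space) indep_vars_reindex_inj:
  assumes X: "indep_vars M' X (f ` I)" and f: "inj_on f I"
  shows "indep_vars (\<lambda>i. M' (f i)) (\<lambda>i. X (f i)) I"
  unfolding indep_vars_def2
proof (intro conjI ballI)
  show "random_variable (M' (f i)) (X (f i))" if "i \<in> I" for i
    using X that by (auto simp: indep_vars_def2)
  have sets: "indep_sets (\<lambda>i. {X i -` A \<inter> space M |A. A \<in> sets (M' i)}) (f ` I)"
    using X by (simp add: indep_vars_def2)
  show "indep_sets (\<lambda>i. {X (f i) -` A \<inter> space M |A. A \<in> sets (M' (f i))}) I"
  proof (rule indep_setsI)
    show "{X (f i) -` A \<inter> space M |A. A \<in> sets (M' (f i))} \<subseteq> events" if "i \<in> I" for i
      using sets that by (auto simp: indep_sets_def)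
    fix A J assume J: "J \<noteq> {}" "J \<subseteq> I" "finite J"
      and A: "\<forall>j\<in>J. A j \<in> {X (f j) -` A \<inter> space M |A. A \<in> sets (M' (f j))}"
    have inj: "inj_on f J" using f J(2) by (rule inj_on_subset)
    define B where "B k = A (the_inv_into J f k)" for k
    have B: "B (f j) = A j" if "j \<in> J" for j
      using that inj by (simp add: B_def the_inv_into_f_f)
    have "prob (\<Inter>k\<in>f ` J. B k) = (\<Prod>k\<in>f ` J. prob (B k))"
      using J A B by (intro indep_setsD[OF sets]) auto
    then show "prob (\<Inter>j\<in>J. A j) = (\<Prod>j\<in>J. prob (A j))"
      using B by (simp add: prod.reindex[OF inj])
  qed
qed

text \<open>In the induction step the cross term factorizes by independence and vanishes because the
  means are zero.\<close>

lemma (in prob_space) second_moment_sum_indep: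
  fixes Y :: "nat \<Rightarrow> 'a \<Rightarrow> real"
  assumes indep: "indep_vars (\<lambda>_. borel) Y UNIV"
    and mean: "\<And>i. expectation (Y i) = 0"
    and sq: "\<And>i. integrable M (\<lambda>\<omega>. (Y i \<omega>)\<^sup>2)"
  shows "integrable M (\<lambda>\<omega>. (\<Sum>i<n. Y i \<omega>)\<^sup>2) \<and>
    expectation (\<lambda>\<omega>. (\<Sum>i<n. Y i \<omega>)\<^sup>2) = (\<Sum>i<n. expectation (\<lambda>\<omega>. (Y i \<omega>)\<^sup>2))"
proof (induction n)
  case 0
  then show ?case by simp
next
  case (Suc n)
  have [measurable]: "Y i \<in> borel_measurable M" for i
    using indep by (simp add: indep_vars_def2)
  have int: "integrable M (Y i)" for i
    by (rule square_integrable_imp_integrable) (use sq in auto)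
  have "indep_var borel (Y n) borel (\<lambda>\<omega>. \<Sum>i<n. Y i \<omega>)"
    by (intro indep_vars_sum indep_vars_subset[OF indep]) auto
  note cross = indep_var_lebesgue_integral[OF this int] indep_var_integrable[OF this int]
  have int_sum: "integrable M (\<lambda>\<omega>. \<Sum>i<n. Y i \<omega>)" using int by auto
  have eq: "(\<Sum>i<Suc n. Y i \<omega>)\<^sup>2 = (\<Sum>i<n. Y i \<omega>)\<^sup>2 + (2 * (Y n \<omega> * (\<Sum>i<n. Y i \<omega>)) + (Y n \<omega>)\<^sup>2)" for \<omega>
    by (simp add: power2_eq_square algebra_simps)
  show ?case
    unfolding eq using Suc sq cross[OF int_sum] by (simp add: mean)
qed

text \<open>If \<open>v = 0\<close> the summands vanish almost surely, a case that really occurs for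
  constant coefficients. Otherwise this is the central limit theorem, with the standard normal
  characteristic function evaluated at \<open>t * \<sigma>\<close>.\<close>

lemma (in prob_space) char_normalized_iid_sum_tendsto:
  fixes Y :: "nat \<Rightarrow> 'a \<Rightarrow> real"
  assumes indep: "indep_vars (\<lambda>_. borel) Y UNIV"
    and mean: "\<And>i. expectation (Y i) = 0"
    and sq: "\<And>i. integrable M (\<lambda>\<omega>. (Y i \<omega>)\<^sup>2)"
    and var: "\<And>i. expectation (\<lambda>\<omega>. (Y i \<omega>)\<^sup>2) = v"
    and distr: "\<And>i. distr M borel (Y i) = \<mu>"
  shows "(\<lambda>n. char (distr M borel (\<lambda>\<omega>. (\<Sum>i<n. Y i \<omega>) / sqrt (real n))) t) \<longlonglongrightarrow> exp (- (t\<^sup>2 * v) / 2)"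
proof (cases "v = 0")
  have Y [measurable]: "Y i \<in> borel_measurable M" for i
    using indep by (simp add: indep_vars_def2)
  case True
  have "AE \<omega> in M. (Y i \<omega>)\<^sup>2 = 0" for i
    using integral_nonneg_eq_0_iff_AE[OF sq[of i]] var True by simp
  then have "AE \<omega> in M. \<forall>i. Y i \<omega> = 0"
    by (simp add: AE_all_countable)
  then have ae: "AE \<omega> in M. iexp (t * ((\<Sum>i<n. Y i \<omega>) / sqrt (real n))) = 1" for n
    by eventually_elim simp
  have "char (distr M borel (\<lambda>\<omega>. (\<Sum>i<n. Y i \<omega>) / sqrt (real n))) t = 1" for n
  proof -
    have "char (distr M borel (\<lambda>\<omega>. (\<Sum>i<n. Y i \<omega>) / sqrt (real n))) t
        = (\<integral>\<omega>. iexp (t * ((\<Sum>i<n. Y i \<omega>) / sqrt (real n))) \<partial>M)"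
      by (rule char_distr) auto
    also have "\<dots> = (\<integral>\<omega>. 1 \<partial>M)"
      by (rule integral_cong_AE) (use ae in auto)
    finally show ?thesis by (simp add: prob_space)
  qed
  with True show ?thesis by simp
next
  have Y [measurable]: "Y i \<in> borel_measurable M" for i
    using indep by (simp add: indep_vars_def2)
  case False
  have "v \<ge> 0" using var[of 0] by (metis integral_nonneg_AE AE_I2 zero_le_power2)
  define \<sigma> where "\<sigma> = sqrt v"
  have \<sigma>: "\<sigma> > 0" "\<sigma>\<^sup>2 = v" using False \<open>v \<ge> 0\<close> by (auto simp: \<sigma>_def)
  have "weak_conv_m (\<lambda>n. distr M borel (\<lambda>x. (\<Sum>i<n. Y i x) / sqrt (real n * \<sigma>\<^sup>2))) std_normal_distribution"
    by (rule central_limit_theorem_zero_mean[OF indep mean \<sigma>(1) sq _ distr])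
      (simp add: mean var \<sigma>)
  then have "(\<lambda>n. char (distr M borel (\<lambda>x. (\<Sum>i<n. Y i x) / sqrt (real n * \<sigma>\<^sup>2))) (t * \<sigma>))
      \<longlonglongrightarrow> char std_normal_distribution (t * \<sigma>)"
    by (intro levy_continuity1 real_distribution_distr real_dist_normal_dist) auto
  moreover have "char (distr M borel (\<lambda>x. (\<Sum>i<n. Y i x) / sqrt (real n * \<sigma>\<^sup>2))) (t * \<sigma>)
      = char (distr M borel (\<lambda>\<omega>. (\<Sum>i<n. Y i \<omega>) / sqrt (real n))) t" for n
  proof -
    have "(t * \<sigma>) * ((\<Sum>i<n. Y i x) / sqrt (real n * \<sigma>\<^sup>2)) = t * ((\<Sum>i<n. Y i x) / sqrt (real n))" for x
      using \<sigma>(1) by (simp add: real_sqrt_mult)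
    note eq = this
    show ?thesis
      by (subst (1 2) char_distr) (auto simp only: eq intro!: Y borel_measurable_divide borel_measurable_sum borel_measurable_const)
  qed
  ultimately show ?thesis
    by (simp add: char_std_normal_distribution power_mult_distrib \<sigma>)
qed

lemma centered_gaussian_rv_measurable:
  "centered_gaussian_rv M Y v \<Longrightarrow> Y \<in> borel_measurable M"
  unfolding centered_gaussian_rv_def using distributed_measurable by fastforce

text \<open>One formula covers the degenerate and the nondegenerate alternative, matching the limit
  obtained for i.i.d. sums.\<close>

lemma (in prob_space) char_centered_gaussian_rv:
  assumes "centered_gaussian_rv M Y v"
  shows "char (distr M borel Y) t = exp (- (t\<^sup>2 * v) / 2)"
proof -
  have Y [measurable]: "Y \<in> borel_measurable M"
    using assms by (rule centered_gaussian_rv_measurable)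
  consider "v = 0" "AE \<omega> in M. Y \<omega> = 0" | "v > 0" "distributed M lborel Y (normal_density 0 (sqrt v))"
    using assms unfolding centered_gaussian_rv_def by auto
  then show ?thesis
  proof cases
    case 1
    from 1(2) have ae: "AE \<omega> in M. iexp (t * Y \<omega>) = 1"
      by eventually_elim simp
    have "char (distr M borel Y) t = (\<integral>\<omega>. iexp (t * Y \<omega>) \<partial>M)"
      by (rule char_distr) auto
    also have "\<dots> = (\<integral>\<omega>. 1 \<partial>M)"
      by (rule integral_cong_AE) (use ae in auto)
    finally show ?thesis using 1 by (simp add: prob_space)
  next
    case 2
    then have "distributed M lborel (\<lambda>x. Y x / sqrt v) std_normal_density"
      using normal_standard_normal_convert[of "sqrt v" Y 0] by simp
    then have "distr M lborel (\<lambda>x. Y x / sqrt v) = std_normal_distribution"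
      by (rule distributed_distr_eq_density)
    moreover have "distr M lborel (\<lambda>x. Y x / sqrt v) = distr M borel (\<lambda>x. Y x / sqrt v)"
      by (rule distr_cong) auto
    ultimately have "char (distr M borel (\<lambda>x. Y x / sqrt v)) (t * sqrt v) = exp (- (t\<^sup>2 * v) / 2)"
      using 2(1) by (simp add: char_std_normal_distribution power_mult_distrib)
    moreover have "char (distr M borel (\<lambda>x. Y x / sqrt v)) (t * sqrt v) = char (distr M borel Y) t"
      using 2(1) by (subst (1 2) char_distr) auto
    ultimately show ?thesis by simp
  qed
qed

lemma (in prob_space) second_moment_centered_gaussian_rv:
  assumes "centered_gaussian_rv M Y v"
  shows "integrable M (\<lambda>\<omega>. (Y \<omega>)\<^sup>2)" "expectation (\<lambda>\<omega>. (Y \<omega>)\<^sup>2) = v"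
proof -
  have Y [measurable]: "Y \<in> borel_measurable M"
    using assms by (rule centered_gaussian_rv_measurable)
  consider "v = 0" "AE \<omega> in M. Y \<omega> = 0" | "v > 0" "distributed M lborel Y (normal_density 0 (sqrt v))"
    using assms unfolding centered_gaussian_rv_def by auto
  then have "integrable M (\<lambda>\<omega>. (Y \<omega>)\<^sup>2) \<and> expectation (\<lambda>\<omega>. (Y \<omega>)\<^sup>2) = v"
  proof cases
    case 1
    from 1(2) have ae: "AE \<omega> in M. (Y \<omega>)\<^sup>2 = 0" by eventually_elim simp
    then have "integrable M (\<lambda>\<omega>. (Y \<omega>)\<^sup>2) \<longleftrightarrow> integrable M (\<lambda>\<omega>. 0::real)"
      by (intro integrable_cong_AE) auto
    moreover have "expectation (\<lambda>\<omega>. (Y \<omega>)\<^sup>2) = expectation (\<lambda>\<omega>. 0::real)"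
      by (intro integral_cong_AE) (use ae in auto)
    ultimately show ?thesis using 1 by simp
  next
    case 2
    have "integrable lborel (\<lambda>x. normal_density 0 (sqrt v) x * x\<^sup>2)"
      using integrable_normal_moment[of "sqrt v" 0 2] 2(1) by simp
    then have "integrable M (\<lambda>\<omega>. (Y \<omega>)\<^sup>2)"
      using distributed_integrable[OF 2(2), of "\<lambda>x. x\<^sup>2"] by simp
    moreover have "expectation (\<lambda>\<omega>. (Y \<omega>)\<^sup>2) = v"
      using normal_distributed_variance[OF _ 2(2)] normal_distributed_expectation[OF _ 2(2)] 2(1) by simp
    ultimately show ?thesis by simp
  qed
  then show "integrable M (\<lambda>\<omega>. (Y \<omega>)\<^sup>2)" "expectation (\<lambda>\<omega>. (Y \<omega>)\<^sup>2) = v" by auto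
qed

section \<open>Lipschitz test functions and stability of weak convergence\<close>

lemma cts_step_lipschitz:
  assumes "a < b"
  shows "\<bar>cts_step a b x - cts_step a b y\<bar> \<le> 1 / (b - a) * \<bar>x - y\<bar>"
proof -
  \<comment> \<open>The step is an affine function clamped to the unit interval, and clamping does
    not increase distances.\<close>
  have eq: "cts_step a b x = max 0 (min 1 ((b - x) / (b - a)))" for x
    using assms by (auto simp: cts_step_def field_simps max_def min_def)
  have "\<bar>cts_step a b x - cts_step a b y\<bar> \<le> \<bar>(b - x) / (b - a) - (b - y) / (b - a)\<bar>"
    unfolding eq by (auto simp: max_def min_def)
  also have "\<dots> = \<bar>(y - x) / (b - a)\<bar>"
    by (simp add: diff_divide_distrib[symmetric])
  also have "\<dots> = 1 / (b - a) * \<bar>x - y\<bar>"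
    using assms by (simp add: abs_minus_commute)
  finally show ?thesis .
qed

text \<open>Continuous mapping theorem on the line: a bounded continuous test function composed with
  \<open>h\<close> is again one. It is applied to squaring, to pass from the distance to its
  square.\<close>

lemma weak_conv_m_continuous_map:
  assumes "prob_space M" "prob_space N" and h: "\<And>x. isCont h x"
    and [measurable]: "\<And>n. W n \<in> borel_measurable M" "Z \<in> borel_measurable N"
    and conv: "weak_conv_m (\<lambda>n. distr M borel (W n)) (distr N borel Z)"
  shows "weak_conv_m (\<lambda>n. distr M borel (\<lambda>\<omega>. h (W n \<omega>))) (distr N borel (\<lambda>\<omega>. h (Z \<omega>)))"
proof -
  interpret M: prob_space M by fact
  interpret N: prob_space N by fact
  have [measurable]: "h \<in> borel_measurable borel"
    using h by (intro borel_measurable_continuous_onI) (simp add: continuous_at_imp_continuous_on)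
  show ?thesis
  proof (rule integral_bdd_continuous_conv_imp_weak_conv)
    fix f :: "real \<Rightarrow> real" assume f: "\<And>x. isCont f x" "\<And>x. \<bar>f x\<bar> \<le> 1"
    have [measurable]: "f \<in> borel_measurable borel"
      using f by (intro borel_measurable_continuous_onI) (simp add: continuous_at_imp_continuous_on)
    have "(\<lambda>n. \<integral>x. f (h x) \<partial>distr M borel (W n)) \<longlonglongrightarrow> (\<integral>x. f (h x) \<partial>distr N borel Z)"
      using f h by (intro weak_conv_imp_integral_bdd_continuous_conv[OF _ _ conv, where B = 1])
        (auto intro!: M.real_distribution_distr N.real_distribution_distr isCont_o2[of _ h f])
    then show "(\<lambda>n. \<integral>x. f x \<partial>distr M borel (\<lambda>\<omega>. h (W n \<omega>))) \<longlonglongrightarrow> (\<integral>x. f x \<partial>distr N borel (\<lambda>\<omega>. h (Z \<omega>)))"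
      by (simp add: integral_distr)
  qed (auto intro!: M.real_distribution_distr N.real_distribution_distr)
qed

text \<open>Complex exponentials of real arguments have modulus 1, so the two characteristic
  functions differ by at most twice the probability of the exceptional event; Levy's theorem then
  transfers the limit.\<close>

lemma weak_conv_m_eq_with_high_probability:
  assumes "prob_space M" "real_distribution \<mu>"
    and [measurable]: "\<And>n. W n \<in> borel_measurable M" "\<And>n. Z n \<in> borel_measurable M" "\<And>n. A n \<in> sets M"
    and conv: "weak_conv_m (\<lambda>n. distr M borel (W n)) \<mu>"
    and A: "(\<lambda>n. measure M (A n)) \<longlonglongrightarrow> 0"
    and eq: "\<And>n. n > 0 \<Longrightarrow> AE \<omega> in M. \<omega> \<notin> A n \<longrightarrow> Z n \<omega> = W n \<omega>"
  shows "weak_conv_m (\<lambda>n. distr M borel (Z n)) \<mu>"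
proof -
  interpret M: prob_space M by fact
  show ?thesis
  proof (rule levy_continuity)
    fix t
    have W: "(\<lambda>n. char (distr M borel (W n)) t) \<longlonglongrightarrow> char \<mu> t"
      by (intro levy_continuity1 M.real_distribution_distr conv assms)
    have "norm (char (distr M borel (Z n)) t - char (distr M borel (W n)) t) \<le> 2 * measure M (A n)"
      if "n > 0" for n
    proof -
      have int: "integrable M (\<lambda>\<omega>. iexp (t * Z n \<omega>))" "integrable M (\<lambda>\<omega>. iexp (t * W n \<omega>))"
        by (rule M.integrable_const_bound[of _ 1]; auto)+
      have "char (distr M borel (Z n)) t - char (distr M borel (W n)) t
          = (\<integral>\<omega>. iexp (t * Z n \<omega>) \<partial>M) - (\<integral>\<omega>. iexp (t * W n \<omega>) \<partial>M)"
        by (subst (1 2) char_distr) auto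
      also have "\<dots> = (\<integral>\<omega>. iexp (t * Z n \<omega>) - iexp (t * W n \<omega>) \<partial>M)"
        using int by simp
      also have "norm \<dots> \<le> (\<integral>\<omega>. norm (iexp (t * Z n \<omega>) - iexp (t * W n \<omega>)) \<partial>M)"
        by (rule integral_norm_bound)
      also have "\<dots> \<le> (\<integral>\<omega>. 2 * indicator (A n) \<omega> \<partial>M)"
      proof (rule integral_mono_AE)
        show "AE \<omega> in M. norm (iexp (t * Z n \<omega>) - iexp (t * W n \<omega>)) \<le> 2 * indicator (A n) \<omega>"
          using eq[OF that]
        proof eventually_elim
          case (elim \<omega>)
          have "norm (iexp (t * Z n \<omega>) - iexp (t * W n \<omega>)) \<le> 1 + 1"
            by (rule norm_triangle_le_diff) simp
          with elim show ?case by (cases "\<omega> \<in> A n") auto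
        qed
        show "integrable M (\<lambda>\<omega>. 2 * indicator (A n) \<omega> :: real)"
          by (rule M.integrable_const_bound[of _ 2]) (auto split: split_indicator)
      qed (use int in auto)
      finally show ?thesis by simp
    qed
    then have "\<forall>\<^sub>F n in sequentially. norm (char (distr M borel (Z n)) t - char (distr M borel (W n)) t) \<le> 2 * measure M (A n)"
      by (intro eventually_sequentiallyI[of 1]) auto
    moreover have "(\<lambda>n. 2 * measure M (A n)) \<longlonglongrightarrow> 0"
      using tendsto_mult_right_zero[OF A, of 2] by simp
    ultimately have "(\<lambda>n. char (distr M borel (Z n)) t - char (distr M borel (W n)) t) \<longlonglongrightarrow> 0"
      by (rule Lim_null_comparison)
    from tendsto_add[OF this W] show "(\<lambda>n. char (distr M borel (Z n)) t) \<longlonglongrightarrow> char \<mu> t" by simp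
  qed (auto intro!: M.real_distribution_distr assms)
qed

section \<open>The empirical process\<close>

lemma measurable_map_count_space:
  fixes X :: "'i \<Rightarrow> 'a \<Rightarrow> 'c::countable"
  assumes "\<And>i. i \<in> set is \<Longrightarrow> X i \<in> measurable M (count_space UNIV)"
  shows "(\<lambda>\<omega>. map (\<lambda>i. X i \<omega>) is) \<in> measurable M (count_space UNIV)"
  using assms
proof (induction "is")
  case (Cons i "is")
  then have "(\<lambda>\<omega>. x # map (\<lambda>i. X i \<omega>) is) \<in> measurable M (count_space UNIV)" for x
    by (intro measurable_compose[where f = "\<lambda>\<omega>. map (\<lambda>i. X i \<omega>) is" and g = "\<lambda>xs. x # xs"]) auto
  from measurable_compose_countable[OF this Cons.prems[of i]] show ?case by simp
qed simp

text \<open>The empirical pmf is determined by the finite list of sample values, which lives in a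
  countable type where every function is measurable. Hence \<open>F\<close> is arbitrary and may
  involve \<open>ls_proj\<close>. Samples are counted from 1 and list positions from 0, hence the
  index \<open>i - 1\<close>.\<close>

lemma measurable_emp_pmf_functional:
  fixes F :: "(nat \<Rightarrow> real) \<Rightarrow> real"
  assumes "\<And>i. i \<ge> 1 \<Longrightarrow> X i \<in> measurable M (count_space UNIV)"
  shows "(\<lambda>\<omega>. F (emp_pmf X n \<omega>)) \<in> borel_measurable M"
proof -
  define e :: "nat list \<Rightarrow> nat \<Rightarrow> real"
    where "e xs j = real (card {i \<in> {1..n}. xs ! (i - 1) = j}) / real n" for xs j
  have "emp_pmf X n \<omega> = e (map (\<lambda>i. X i \<omega>) [1..<n+1])" for \<omega>
  proof
    fix j
    have "{i \<in> {1..n}. X i \<omega> = j} = {i \<in> {1..n}. map (\<lambda>i. X i \<omega>) [1..<n+1] ! (i - 1) = j}"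
      by (auto simp del: upt_Suc)
    then show "emp_pmf X n \<omega> j = e (map (\<lambda>i. X i \<omega>) [1..<n+1]) j"
      by (simp add: emp_pmf_def e_def del: upt_Suc)
  qed
  then have eq: "(\<lambda>\<omega>. F (emp_pmf X n \<omega>)) = (\<lambda>\<omega>. F (e (map (\<lambda>i. X i \<omega>) [1..<n+1])))" by simp
  show ?thesis
    unfolding eq
    by (intro measurable_compose[OF measurable_map_count_space[of "[1..<n+1]" X], where g = "\<lambda>xs. F (e xs)"])
      (use assms in auto)
qed

lemma sqrt_T0_hat_measurable:
  assumes "\<And>k. k \<in> {0..S+1} \<Longrightarrow> (\<lambda>\<omega>. V \<omega> k) \<in> borel_measurable M"
  shows "(\<lambda>\<omega>. sqrt (T0_hat p S (V \<omega>))) \<in> borel_measurable M"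
proof (rule borel_measurable_lipschitz_coordinates[where f = "\<lambda>x. sqrt (T0_hat p S x)" and K = 1 and I = "{0..S+1}"])
  show "\<bar>sqrt (T0_hat p S x) - sqrt (T0_hat p S y)\<bar> \<le> 1 * (\<Sum>k\<in>{0..S+1}. \<bar>x k - y k\<bar>)" for x y
    using sqrt_T0_hat_lipschitz[of p S x y] by simp
qed (rule assms)

section \<open>The scaled empirical process of an i.i.d. sample\<close>

locale iid_sample = prob_space M for M :: "'a measure" +
  fixes X :: "nat \<Rightarrow> 'a \<Rightarrow> nat" and p0 :: "nat \<Rightarrow> real"
  assumes indep: "indep_vars (\<lambda>_. count_space UNIV) X {1..}"
    and law: "\<And>i j. i \<ge> 1 \<Longrightarrow> prob {\<omega> \<in> space M. X i \<omega> = j} = p0 j"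
begin

definition emp_process :: "nat \<Rightarrow> 'a \<Rightarrow> nat \<Rightarrow> real" where
  "emp_process n \<omega> k = sqrt (real n) * (emp_pmf X n \<omega> k - p0 k)"

text \<open>A linear form of the empirical process is a normalized sum of these centred variables.
  The coefficient function is extended by 0 outside \<open>I\<close>, and \<open>Suc\<close> aligns
  the sample, which starts at 1, with sums over \<open>i < n\<close>.\<close>

definition dev :: "nat set \<Rightarrow> (nat \<Rightarrow> real) \<Rightarrow> nat \<Rightarrow> 'a \<Rightarrow> real" where
  "dev I c i \<omega> = (if X (Suc i) \<omega> \<in> I then c (X (Suc i) \<omega>) else 0) - (\<Sum>k\<in>I. c k * p0 k)"

lemma X_measurable: "i \<ge> 1 \<Longrightarrow> X i \<in> measurable M (count_space UNIV)"
  using indep by (simp add: indep_vars_def2)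

lemma expectation_finite_support:
  assumes "finite I" and f: "\<And>j. j \<notin> I \<Longrightarrow> f j = 0" and i: "i \<ge> 1"
  shows "integrable M (\<lambda>\<omega>. f (X i \<omega>))" "expectation (\<lambda>\<omega>. f (X i \<omega>)) = (\<Sum>j\<in>I. f j * p0 j)"
proof -
  define A where "A j = {\<omega> \<in> space M. X i \<omega> = j}" for j
  have A [measurable]: "A j \<in> events" for j
    using measurable_sets[OF X_measurable[OF i], of "{j}"] by (simp add: A_def vimage_def Int_def conj_commute)
  have f_eq: "f (X i \<omega>) = (\<Sum>j\<in>I. f j * indicator (A j) \<omega>)" if "\<omega> \<in> space M" for \<omega>
  proof -
    have "(\<Sum>j\<in>I. f j * indicator (A j) \<omega>) = (\<Sum>j\<in>I. if X i \<omega> = j then f j else 0)"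
      using that by (intro sum.cong) (auto simp: A_def)
    also have "\<dots> = f (X i \<omega>)" using assms by (simp add: sum.delta')
    finally show ?thesis by simp
  qed
  have int: "integrable M (\<lambda>\<omega>. f j * indicator (A j) \<omega>)" for j
    by (rule integrable_const_bound[of _ "\<bar>f j\<bar>"]) (auto split: split_indicator)
  have "integrable M (\<lambda>\<omega>. \<Sum>j\<in>I. f j * indicator (A j) \<omega>)"
    by (intro Bochner_Integration.integrable_sum int)
  then show "integrable M (\<lambda>\<omega>. f (X i \<omega>))"
    by (rule Bochner_Integration.integrable_cong[THEN iffD1, rotated 2]) (auto simp: f_eq)
  have "expectation (\<lambda>\<omega>. f (X i \<omega>)) = expectation (\<lambda>\<omega>. \<Sum>j\<in>I. f j * indicator (A j) \<omega>)"
    by (rule Bochner_Integration.integral_cong) (auto simp: f_eq)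
  also have "\<dots> = (\<Sum>j\<in>I. expectation (\<lambda>\<omega>. f j * indicator (A j) \<omega>))"
    by (rule Bochner_Integration.integral_sum) (rule int)
  also have "\<dots> = (\<Sum>j\<in>I. f j * p0 j)"
    using law[OF i] by (simp add: A_def[symmetric])
  finally show "expectation (\<lambda>\<omega>. f (X i \<omega>)) = (\<Sum>j\<in>I. f j * p0 j)" .
qed

lemma dev_indep: "indep_vars (\<lambda>_. borel) (dev I c) UNIV"
proof -
  have "indep_vars (\<lambda>_. count_space UNIV) (\<lambda>i. X (Suc i)) UNIV"
    using indep_vars_reindex_inj[of "\<lambda>_. count_space UNIV" X Suc UNIV]
      indep_vars_subset[OF indep, of "range Suc"] by auto
  then show ?thesis
    unfolding dev_def[abs_def] by (rule indep_vars_compose2) auto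
qed

text \<open>A law on a countable space is determined by its point masses, here all given by
  \<open>p0\<close>.\<close>

lemma dev_distr: "distr M borel (dev I c i) = distr M borel (dev I c 0)"
proof -
  define h where "h j = (if j \<in> I then c j else 0) - (\<Sum>k\<in>I. c k * p0 k)" for j
  have "distr M (count_space UNIV) (X (Suc i)) = distr M (count_space UNIV) (X (Suc 0))"
  proof (rule measure_eqI_countable[where A = UNIV])
    fix j
    have "emeasure (distr M (count_space UNIV) (X (Suc i))) {j} = ennreal (p0 j)" for i
    proof -
      have "emeasure (distr M (count_space UNIV) (X (Suc i))) {j} = emeasure M {\<omega> \<in> space M. X (Suc i) \<omega> = j}"
        by (subst emeasure_distr) (auto simp: X_measurable intro!: arg_cong[where f = "emeasure M"])
      then show ?thesis by (simp add: emeasure_eq_measure law)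
    qed
    then show "emeasure (distr M (count_space UNIV) (X (Suc i))) {j} = emeasure (distr M (count_space UNIV) (X (Suc 0))) {j}"
      by simp
  qed auto
  moreover have "distr M borel (dev I c i) = distr (distr M (count_space UNIV) (X (Suc i))) borel h" for i
    by (subst distr_distr) (auto simp: X_measurable o_def h_def dev_def[abs_def])
  ultimately show ?thesis by simp
qed

lemma dev_moments:
  assumes "finite I"
  shows "expectation (dev I c i) = 0" "integrable M (\<lambda>\<omega>. (dev I c i \<omega>)\<^sup>2)"
    "expectation (\<lambda>\<omega>. (dev I c i \<omega>)\<^sup>2) =
      (\<Sum>i\<in>I. \<Sum>j\<in>I. c i * c j * ((if i = j then p0 i else 0) - p0 i * p0 j))"
proof -
  define f where "f j = (if j \<in> I then c j else 0)" for j
  define m where "m = (\<Sum>k\<in>I. c k * p0 k)"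
  note f = expectation_finite_support[OF assms, of f "Suc i"]
  note f2 = expectation_finite_support[OF assms, of "\<lambda>j. (f j)\<^sup>2" "Suc i"]
  have f_sum: "(\<Sum>j\<in>I. f j * p0 j) = m" "(\<Sum>j\<in>I. (f j)\<^sup>2 * p0 j) = (\<Sum>j\<in>I. (c j)\<^sup>2 * p0 j)"
    by (simp_all add: f_def m_def)
  have f0: "\<And>j. j \<notin> I \<Longrightarrow> f j = 0" by (simp add: f_def)
  have dev: "dev I c i = (\<lambda>\<omega>. f (X (Suc i) \<omega>) - m)"
    by (simp add: dev_def f_def m_def fun_eq_iff)
  show "expectation (dev I c i) = 0"
    using f f0 by (simp add: dev f_sum prob_space)
  have sq: "(dev I c i \<omega>)\<^sup>2 = (f (X (Suc i) \<omega>))\<^sup>2 - (2 * m) * f (X (Suc i) \<omega>) + m\<^sup>2" for \<omega>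
    by (simp add: dev power2_eq_square algebra_simps)
  show "integrable M (\<lambda>\<omega>. (dev I c i \<omega>)\<^sup>2)"
    unfolding sq using f f2 f0 by simp
  have "expectation (\<lambda>\<omega>. (dev I c i \<omega>)\<^sup>2) = (\<Sum>j\<in>I. (c j)\<^sup>2 * p0 j) - (2 * m) * m + m\<^sup>2"
    unfolding sq using f f2 f0 by (simp add: f_sum prob_space)
  also have "\<dots> = (\<Sum>j\<in>I. (c j)\<^sup>2 * p0 j) - m * m"
    by (simp add: power2_eq_square)
  \<comment> \<open>The variance is second moment minus squared mean; both are expanded into double
    sums to match the Gaussian covariance form.\<close>
  also have "m * m = (\<Sum>i\<in>I. \<Sum>j\<in>I. c i * c j * (p0 i * p0 j))"
    unfolding m_def sum_product by (simp add: algebra_simps)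
  also have "(\<Sum>j\<in>I. (c j)\<^sup>2 * p0 j) = (\<Sum>i\<in>I. \<Sum>j\<in>I. c i * c j * (if i = j then p0 i else 0))"
    using assms by (simp add: if_distrib[of "\<lambda>x. _ * x"] power2_eq_square cong: if_cong)
  finally show "expectation (\<lambda>\<omega>. (dev I c i \<omega>)\<^sup>2) =
      (\<Sum>i\<in>I. \<Sum>j\<in>I. c i * c j * ((if i = j then p0 i else 0) - p0 i * p0 j))"
    by (simp only: right_diff_distrib sum_subtractf)
qed

lemma emp_pmf_sum:
  assumes "finite I"
  shows "(\<Sum>k\<in>I. c k * emp_pmf X n \<omega> k) = (\<Sum>i<n. if X (Suc i) \<omega> \<in> I then c (X (Suc i) \<omega>) else 0) / real n"
proof -
  have card: "real (card {i \<in> {1..n}. X i \<omega> = k}) = (\<Sum>i<n. if X (Suc i) \<omega> = k then 1 else 0)" for k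
  proof -
    have "real (card {i \<in> {1..n}. X i \<omega> = k}) = (\<Sum>i\<in>{1..n}. if X i \<omega> = k then 1 else 0)"
      by (simp add: sum.If_cases Int_def)
    also have "\<dots> = (\<Sum>i\<in>Suc ` {..<n}. if X i \<omega> = k then 1 else 0)"
      by (simp only: image_Suc_lessThan)
    also have "\<dots> = (\<Sum>i<n. if X (Suc i) \<omega> = k then 1 else 0)"
      by (subst sum.reindex) (auto simp: o_def)
    finally show ?thesis .
  qed
  have "(\<Sum>k\<in>I. c k * emp_pmf X n \<omega> k) = (\<Sum>k\<in>I. \<Sum>i<n. if X (Suc i) \<omega> = k then c k else 0) / real n"
    unfolding emp_pmf_def card
    by (simp add: sum_divide_distrib sum_distrib_left if_distrib[of "\<lambda>x. _ * x"] cong: if_cong)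
  also have "(\<Sum>k\<in>I. \<Sum>i<n. if X (Suc i) \<omega> = k then c k else 0) =
      (\<Sum>i<n. \<Sum>k\<in>I. if X (Suc i) \<omega> = k then c k else 0)"
    by (rule sum.swap)
  also have "\<dots> = (\<Sum>i<n. if X (Suc i) \<omega> \<in> I then c (X (Suc i) \<omega>) else 0)"
    using assms by (simp add: sum.delta')
  finally show ?thesis .
qed

lemma emp_process_sum:
  assumes "finite I"
  shows "(\<Sum>k\<in>I. c k * emp_process n \<omega> k) = (\<Sum>i<n. dev I c i \<omega>) / sqrt (real n)"
proof (cases "n = 0")
  \<comment> \<open>For \<open>n = 0\<close> both sides are 0, by the factor \<open>sqrt 0\<close>
    and the empty sum; so only positive \<open>n\<close> needs computation.\<close>
  case False
  define m where "m = (\<Sum>k\<in>I. c k * p0 k)"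
  define s where "s = (\<Sum>i<n. if X (Suc i) \<omega> \<in> I then c (X (Suc i) \<omega>) else 0)"
  have "(\<Sum>k\<in>I. c k * emp_process n \<omega> k) = sqrt (real n) * ((\<Sum>k\<in>I. c k * emp_pmf X n \<omega> k) - m)"
    by (simp add: emp_process_def m_def sum_distrib_left sum_subtractf algebra_simps)
  also have "\<dots> = sqrt (real n) * (s / real n - m)"
    using emp_pmf_sum[OF assms] by (simp add: s_def)
  also have "\<dots> = (s - real n * m) / sqrt (real n)"
    using False by (simp add: field_simps)
  also have "s - real n * m = (\<Sum>i<n. dev I c i \<omega>)"
    by (simp add: dev_def s_def m_def sum_subtractf)
  finally show ?thesis .
qed (simp add: emp_process_def)

lemma emp_process_measurable: "(\<lambda>\<omega>. emp_process n \<omega> k) \<in> borel_measurable M"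
  unfolding emp_process_def
  using measurable_emp_pmf_functional[of X M "\<lambda>p. sqrt (real n) * (p k - p0 k)" n] X_measurable by simp

text \<open>For positive \<open>n\<close> the second moment is the variance of a single indicator,
  independent of \<open>n\<close>. The uniform bound feeds both the Cramer-Wold argument and the
  Chebyshev estimate.\<close>

lemma emp_process_second_moment:
  shows "integrable M (\<lambda>\<omega>. (emp_process n \<omega> k)\<^sup>2)" "expectation (\<lambda>\<omega>. (emp_process n \<omega> k)\<^sup>2) \<le> 1"
proof -
  have eq: "(emp_process n \<omega> k)\<^sup>2 = (\<Sum>i<n. dev {k} (\<lambda>_. 1) i \<omega>)\<^sup>2 / real n" for \<omega>
    using emp_process_sum[of "{k}" "\<lambda>_. 1" n \<omega>] by (simp add: power_divide)
  note m = second_moment_sum_indep[OF dev_indep dev_moments(1,2), of "{k}" "\<lambda>_. 1" n]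
  show "integrable M (\<lambda>\<omega>. (emp_process n \<omega> k)\<^sup>2)"
    unfolding eq using m by simp
  have "expectation (\<lambda>\<omega>. (emp_process n \<omega> k)\<^sup>2) = real n * (p0 k - p0 k * p0 k) / real n"
    unfolding eq using m by (simp add: dev_moments(3))
  also have "\<dots> \<le> 1"
  proof -
    have "0 \<le> p0 k" "p0 k \<le> 1" using law[of 1 k] by (auto simp flip: law[of 1])
    moreover have "0 \<le> p0 k * p0 k" by simp
    ultimately have "p0 k - p0 k * p0 k \<le> 1" by linarith
    then show ?thesis by (cases "n = 0") auto
  qed
  finally show "expectation (\<lambda>\<omega>. (emp_process n \<omega> k)\<^sup>2) \<le> 1" .
qed

text \<open>Levy's theorem: the limiting characteristic function and that of the Gaussian form
  contain the same quadratic form in \<open>c\<close>.\<close>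

lemma emp_process_weak_conv:
  assumes "prob_space N" "finite I"
    and G: "centered_gaussian_vector N I G (\<lambda>i j. (if i = j then p0 i else 0) - p0 i * p0 j)"
  shows "weak_conv_m (\<lambda>n. distr M borel (\<lambda>\<omega>. \<Sum>k\<in>I. c k * emp_process n \<omega> k))
    (distr N borel (\<lambda>\<omega>. \<Sum>k\<in>I. c k * G \<omega> k))"
proof (rule levy_continuity)
  interpret N: prob_space N by fact
  let ?v = "\<Sum>i\<in>I. \<Sum>j\<in>I. c i * c j * ((if i = j then p0 i else 0) - p0 i * p0 j)"
  have g: "centered_gaussian_rv N (\<lambda>\<omega>. \<Sum>k\<in>I. c k * G \<omega> k) ?v"
    using G by (simp add: centered_gaussian_vector_def)
  show "real_distribution (distr N borel (\<lambda>\<omega>. \<Sum>k\<in>I. c k * G \<omega> k))"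
    by (intro N.real_distribution_distr centered_gaussian_rv_measurable[OF g])
  show "real_distribution (distr M borel (\<lambda>\<omega>. \<Sum>k\<in>I. c k * emp_process n \<omega> k))" for n
    using emp_process_measurable by (intro real_distribution_distr borel_measurable_sum) auto
  show "(\<lambda>n. char (distr M borel (\<lambda>\<omega>. \<Sum>k\<in>I. c k * emp_process n \<omega> k)) t)
      \<longlonglongrightarrow> char (distr N borel (\<lambda>\<omega>. \<Sum>k\<in>I. c k * G \<omega> k)) t" for t
    unfolding N.char_centered_gaussian_rv[OF g] emp_process_sum[OF \<open>finite I\<close>]
    using dev_moments[OF \<open>finite I\<close>] dev_distr by (intro char_normalized_iid_sum_tendsto dev_indep) auto
qed

text \<open>A continuous step applied to the distance is bounded and Lipschitz in the coordinates,
  so \<open>cramer_wold_lipschitz\<close> applies; such steps suffice for weak convergence of the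
  distance, and squaring gives \<open>T0_hat\<close>.\<close>

lemma
  assumes N: "prob_space N"
    and G: "centered_gaussian_vector N {0..S+1} G (\<lambda>i j. (if i = j then p0 i else 0) - p0 i * p0 j)"
  shows T0_hat_emp_process_weak_conv: "weak_conv_m (\<lambda>n. distr M borel (\<lambda>\<omega>. T0_hat p0 S (emp_process n \<omega>)))
      (distr N borel (\<lambda>\<omega>. T0_hat p0 S (G \<omega>)))"
    and T0_hat_gaussian_measurable: "(\<lambda>\<omega>. T0_hat p0 S (G \<omega>)) \<in> borel_measurable N"
    and T0_hat_emp_process_measurable: "(\<lambda>\<omega>. T0_hat p0 S (emp_process n \<omega>)) \<in> borel_measurable M"
proof -
  interpret N: prob_space N by fact
  define I where "I = {0..S+1}"
  have "finite I" by (simp add: I_def)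
  have coord: "centered_gaussian_rv N (\<lambda>\<omega>. G \<omega> k) (p0 k - p0 k * p0 k)" if "k \<in> I" for k
  proof -
    define c :: "nat \<Rightarrow> real" where "c i = (if i = k then 1 else 0)" for i
    have "centered_gaussian_rv N (\<lambda>\<omega>. \<Sum>i\<in>I. c i * G \<omega> i)
        (\<Sum>i\<in>I. \<Sum>j\<in>I. c i * c j * ((if i = j then p0 i else 0) - p0 i * p0 j))"
      using G unfolding centered_gaussian_vector_def I_def by blast
    moreover have "(\<Sum>i\<in>I. c i * G \<omega> i) = G \<omega> k" for \<omega>
      using that \<open>finite I\<close> by (simp add: c_def if_distrib[of "\<lambda>x. x * _"] cong: if_cong)
    moreover have "(\<Sum>i\<in>I. \<Sum>j\<in>I. c i * c j * ((if i = j then p0 i else 0) - p0 i * p0 j)) = p0 k - p0 k * p0 k"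
    proof -
      have "(\<Sum>i\<in>I. \<Sum>j\<in>I. c i * c j * ((if i = j then p0 i else 0) - p0 i * p0 j)) =
          (\<Sum>i\<in>I. \<Sum>j\<in>I. if j = k then (if i = k then p0 k - p0 k * p0 k else 0) else 0)"
        by (intro sum.cong refl) (auto simp: c_def)
      also have "\<dots> = p0 k - p0 k * p0 k"
        using that \<open>finite I\<close> by simp
      finally show ?thesis .
    qed
    ultimately show ?thesis by simp
  qed
  have G_meas: "(\<lambda>\<omega>. G \<omega> k) \<in> borel_measurable N" if "k \<in> I" for k
    using coord[OF that] by (rule centered_gaussian_rv_measurable)
  have meas: "(\<lambda>\<omega>. sqrt (T0_hat p0 S (G \<omega>))) \<in> borel_measurable N"
      "(\<lambda>\<omega>. sqrt (T0_hat p0 S (emp_process n \<omega>))) \<in> borel_measurable M" for n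
    by (rule sqrt_T0_hat_measurable; use G_meas emp_process_measurable in \<open>simp add: I_def\<close>)+
  have conv: "weak_conv_m (\<lambda>n. distr M borel (\<lambda>\<omega>. sqrt (T0_hat p0 S (emp_process n \<omega>))))
    (distr N borel (\<lambda>\<omega>. sqrt (T0_hat p0 S (G \<omega>))))"
  proof (rule integral_cts_step_conv_imp_weak_conv)
    fix a b :: real assume "a < b"
    have cts [measurable]: "cts_step a b \<in> borel_measurable borel"
      using cts_step_uniformly_continuous[OF \<open>a < b\<close>]
      by (intro borel_measurable_continuous_onI uniformly_continuous_imp_continuous)
    define f where "f x = cts_step a b (sqrt (T0_hat p0 S x))" for x
    have "(\<lambda>n. \<integral>\<omega>. f (emp_process n \<omega>) \<partial>M) \<longlonglongrightarrow> (\<integral>\<omega>. f (G \<omega>) \<partial>N)"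
    proof (rule cramer_wold_lipschitz[where f = f and V = emp_process and G = G and I = I and B = 1 and K = "1 / (b - a)" and C = 1])
      show "weak_conv_m (\<lambda>n. distr M borel (\<lambda>\<omega>. \<Sum>k\<in>I. c k * emp_process n \<omega> k))
          (distr N borel (\<lambda>\<omega>. \<Sum>k\<in>I. c k * G \<omega> k))" for c
        using G by (intro emp_process_weak_conv N) (auto simp: I_def)
      show "(\<integral>\<omega>. (G \<omega> k)\<^sup>2 \<partial>N) \<le> 1" if "k \<in> I" for k
      proof -
        have "0 \<le> p0 k" "p0 k \<le> 1" by (auto simp flip: law[of 1])
        moreover have "0 \<le> p0 k * p0 k" by simp
        ultimately show ?thesis
          using N.second_moment_centered_gaussian_rv(2)[OF coord[OF that]] by linarith
      qed
      show "\<bar>f x - f y\<bar> \<le> 1 / (b - a) * (\<Sum>k\<in>I. \<bar>x k - y k\<bar>)" for x y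
      proof -
        have "\<bar>f x - f y\<bar> \<le> 1 / (b - a) * \<bar>sqrt (T0_hat p0 S x) - sqrt (T0_hat p0 S y)\<bar>"
          unfolding f_def by (rule cts_step_lipschitz[OF \<open>a < b\<close>])
        also have "\<dots> \<le> 1 / (b - a) * (\<Sum>k\<in>I. \<bar>x k - y k\<bar>)"
          unfolding I_def using \<open>a < b\<close> by (intro mult_left_mono sqrt_T0_hat_lipschitz) auto
        finally show ?thesis .
      qed
      show "\<bar>f x\<bar> \<le> 1" for x
        using \<open>a < b\<close> by (auto simp: f_def cts_step_def)
      show "prob_space M" by (rule prob_space_axioms)
      show "prob_space N" by (rule N)
      show "finite I" by (rule \<open>finite I\<close>)
      show "(\<lambda>\<omega>. emp_process n \<omega> k) \<in> borel_measurable M" for n k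
        by (rule emp_process_measurable)
      show "(\<lambda>\<omega>. G \<omega> k) \<in> borel_measurable N" if "k \<in> I" for k
        using that by (rule G_meas)
      show "integrable M (\<lambda>\<omega>. (emp_process n \<omega> k)\<^sup>2)" "(\<integral>\<omega>. (emp_process n \<omega> k)\<^sup>2 \<partial>M) \<le> 1" for n k
        by (rule emp_process_second_moment)+
      show "integrable N (\<lambda>\<omega>. (G \<omega> k)\<^sup>2)" if "k \<in> I" for k
        by (rule N.second_moment_centered_gaussian_rv(1)[OF coord[OF that]])
    qed
    then show "(\<lambda>n. integral\<^sup>L (distr M borel (\<lambda>\<omega>. sqrt (T0_hat p0 S (emp_process n \<omega>)))) (cts_step a b))
        \<longlonglongrightarrow> integral\<^sup>L (distr N borel (\<lambda>\<omega>. sqrt (T0_hat p0 S (G \<omega>)))) (cts_step a b)"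
      using meas by (simp add: integral_distr f_def)
  qed (use meas in \<open>auto intro!: real_distribution_distr N.real_distribution_distr\<close>)
  show "weak_conv_m (\<lambda>n. distr M borel (\<lambda>\<omega>. T0_hat p0 S (emp_process n \<omega>)))
      (distr N borel (\<lambda>\<omega>. T0_hat p0 S (G \<omega>)))"
    using weak_conv_m_continuous_map[OF prob_space_axioms N _ meas(2,1) conv, of "\<lambda>x. x\<^sup>2"]
    by (simp add: T0_hat_nonneg)
  show "(\<lambda>\<omega>. T0_hat p0 S (G \<omega>)) \<in> borel_measurable N"
    using borel_measurable_power[OF meas(1), where n = 2] by (simp add: T0_hat_nonneg)
  show "(\<lambda>\<omega>. T0_hat p0 S (emp_process n \<omega>)) \<in> borel_measurable M"
    using borel_measurable_power[OF meas(2)[of n], where n = 2] by (simp add: T0_hat_nonneg)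
qed

text \<open>Union bound over the \<open>S + 2\<close> coordinates with Chebyshev's inequality,
  giving order \<open>1 / n\<close>. The threshold carries \<open>sqrt (real n)\<close> because the
  process is scaled by it.\<close>

lemma prob_emp_pmf_far_tendsto_0:
  fixes \<delta> :: real and S :: nat
  assumes "\<delta> > 0"
  defines "A n \<equiv> {\<omega> \<in> space M. \<exists>k\<in>{0..S+1}. \<delta> * sqrt (real n) \<le> \<bar>emp_process n \<omega> k\<bar>}"
  shows "A n \<in> events" "(\<lambda>n. prob (A n)) \<longlonglongrightarrow> 0"
proof -
  note [measurable] = emp_process_measurable
  show events: "A n \<in> events" for n unfolding A_def by measurable
  have bound: "prob (A n) \<le> (real S + 2) / \<delta>\<^sup>2 * inverse (real n)" if "n > 0" for n
  proof -
    let ?B = "\<lambda>k. {\<omega> \<in> space M. \<delta> * sqrt (real n) \<le> \<bar>emp_process n \<omega> k\<bar>}"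
    have "A n = (\<Union>k\<in>{0..S+1}. ?B k)" by (auto simp: A_def)
    then have "prob (A n) \<le> (\<Sum>k\<in>{0..S+1}. prob (?B k))"
      using measure_UNION_le[of "{0..S+1}" ?B M] by simp
    also have "\<dots> \<le> (\<Sum>k\<in>{0..S+1}. 1 / (\<delta>\<^sup>2 * real n))"
    proof (rule sum_mono)
      fix k
      have "prob (?B k) \<le> expectation (\<lambda>\<omega>. (emp_process n \<omega> k)\<^sup>2) / (\<delta> * sqrt (real n))\<^sup>2"
        using assms that by (intro second_moment_method emp_process_second_moment) auto
      also have "\<dots> \<le> 1 / (\<delta> * sqrt (real n))\<^sup>2"
        by (intro divide_right_mono emp_process_second_moment) auto
      finally show "prob (?B k) \<le> 1 / (\<delta>\<^sup>2 * real n)"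
        by (simp add: power_mult_distrib)
    qed
    also have "\<dots> = (real S + 2) / \<delta>\<^sup>2 * inverse (real n)"
      by (simp add: divide_inverse add_ac)
    finally show ?thesis .
  qed
  have "(\<lambda>n. (real S + 2) / \<delta>\<^sup>2 * inverse (real n)) \<longlonglongrightarrow> 0"
    by (intro tendsto_mult_right_zero lim_inverse_n)
  moreover have "\<forall>\<^sub>F n in sequentially. norm (prob (A n)) \<le> (real S + 2) / \<delta>\<^sup>2 * inverse (real n)"
    using bound by (intro eventually_sequentiallyI[of 1]) auto
  ultimately show "(\<lambda>n. prob (A n)) \<longlonglongrightarrow> 0"
    by (rule Lim_null_comparison[rotated])
qed

text \<open>There are countably many pairs of sample index and forbidden value, so one null set
  serves them all.\<close>

lemma AE_sample_in_support:
  assumes "\<And>j. j > S \<Longrightarrow> p0 j = 0"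
  shows "AE \<omega> in M. \<forall>i\<ge>1. X i \<omega> \<le> S"
proof -
  have "AE \<omega> in M. X i \<omega> \<noteq> j" if "i \<ge> 1" "j > S" for i j
  proof (rule AE_I)
    show "{\<omega> \<in> space M. \<not> X i \<omega> \<noteq> j} \<subseteq> {\<omega> \<in> space M. X i \<omega> = j}" by auto
    show "emeasure M {\<omega> \<in> space M. X i \<omega> = j} = 0"
      using law[OF that(1), of j] assms[OF that(2)] by (simp add: emeasure_eq_measure)
    show "{\<omega> \<in> space M. X i \<omega> = j} \<in> events"
      using measurable_sets[OF X_measurable[OF that(1)], of "{j}"] by (simp add: vimage_def Int_def conj_commute)
  qed
  then have "AE \<omega> in M. \<forall>i j. i \<ge> 1 \<longrightarrow> j > S \<longrightarrow> X i \<omega> \<noteq> j"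
    by (auto simp: AE_all_countable)
  then show ?thesis
    by eventually_elim (metis not_le)
qed

end

section \<open>Transfer of the limit to the least-squares statistic\<close>

theorem theorem1:
  fixes M :: "'a measure" and X :: "nat \<Rightarrow> 'a \<Rightarrow> nat" and p0 :: "nat \<Rightarrow> real" and S :: nat
    and N :: "'b measure" and g0 :: "'b \<Rightarrow> nat \<Rightarrow> real"
  assumes "prob_space M"
    and "S > 0"
    and "is_pmf p0"
    and "\<forall>j. p0 j > 0 \<longleftrightarrow> j \<le> S"
    and "convex_seq p0"
    and "prob_space.indep_vars M (\<lambda>_. count_space UNIV) X {1..}"
    and "\<forall>i\<ge>1. \<forall>j. measure M {\<omega> \<in> space M. X i \<omega> = j} = p0 j"
    and "prob_space N"
    and "centered_gaussian_vector N {0..S+1} g0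
           (\<lambda>i j. (if i = j then p0 i else 0) - p0 i * p0 j)"
  shows "weak_conv_m (\<lambda>n. distr M borel (Tn_sq X n)) (distr N borel (\<lambda>\<omega>. T0_hat p0 S (g0 \<omega>)))"
proof -
  interpret iid_sample M X p0
    using assms by (simp add: iid_sample_def iid_sample_axioms_def)
  interpret N: prob_space N by fact
  note limit = T0_hat_emp_process_weak_conv[OF assms(8,9)] T0_hat_gaussian_measurable[OF assms(8,9)]
    T0_hat_emp_process_measurable[OF assms(8,9)]
  obtain \<delta> where \<delta>: "\<delta> > 0"
    "\<And>q. (\<And>j. j \<le> S + 1 \<Longrightarrow> \<bar>q j - p0 j\<bar> \<le> \<delta>) \<Longrightarrow> (\<And>j. j > S \<Longrightarrow> q j = 0) \<Longrightarrow> (\<Sum>j=0..S+1. q j) = 1 \<Longrightarrow>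
      sqnorm (\<lambda>j. q j - ls_proj q j) = T0_hat p0 S (\<lambda>j. q j - p0 j)"
    using ls_proj_near[of p0 S] assms(3,4,5) by blast
  have p0_0: "p0 j = 0" if "j > S" for j
    using assms(3) assms(4)[rule_format, of j] that by (auto simp: is_pmf_def not_le less_le)
  \<comment> \<open>The exceptional event: outside it, the empirical pmf is within \<delta> of
    \<open>p0\<close> on the whole window, as required by the choice of \<delta>.\<close>
  define A where "A n = {\<omega> \<in> space M. \<exists>k\<in>{0..S+1}. \<delta> * sqrt (real n) \<le> \<bar>emp_process n \<omega> k\<bar>}" for n
  show ?thesis
  proof (rule weak_conv_m_eq_with_high_probability[OF assms(1) _ _ _ _ limit(1), where A = A])
    show "A n \<in> sets M" "(\<lambda>n. measure M (A n)) \<longlonglongrightarrow> 0" for n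
      unfolding A_def by (rule prob_emp_pmf_far_tendsto_0[OF \<delta>(1)])+
    show "Tn_sq X n \<in> borel_measurable M" for n
      using measurable_emp_pmf_functional[of X M "\<lambda>p. real n * sqnorm (\<lambda>j. p j - ls_proj p j)" n] X_measurable
      by (simp add: Tn_sq_def[abs_def])
    fix n :: nat assume "n > 0"
    have "AE \<omega> in M. \<forall>i\<ge>1. X i \<omega> \<le> S"
      using p0_0 by (rule AE_sample_in_support)
    then show "AE \<omega> in M. \<omega> \<notin> A n \<longrightarrow> Tn_sq X n \<omega> = T0_hat p0 S (emp_process n \<omega>)"
      using AE_space
    proof eventually_elim
      case (elim \<omega>)
      show ?case
      proof
        assume "\<omega> \<notin> A n"
        let ?q = "emp_pmf X n \<omega>"
        have "sqnorm (\<lambda>j. ?q j - ls_proj ?q j) = T0_hat p0 S (\<lambda>j. ?q j - p0 j)"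
        proof (rule \<delta>(2))
          fix j assume "j \<le> S + 1"
          then have "sqrt (real n) * \<bar>?q j - p0 j\<bar> \<le> sqrt (real n) * \<delta>"
            using \<open>\<omega> \<notin> A n\<close> elim
            by (force simp: A_def emp_process_def abs_mult mult.commute not_le less_imp_le)
          then show "\<bar>?q j - p0 j\<bar> \<le> \<delta>" using \<open>n > 0\<close> by simp
        next
          fix j assume "j > S"
          then have "{i \<in> {1..n}. X i \<omega> = j} = {}" using elim by fastforce
          then show "?q j = 0" by (simp add: emp_pmf_def)
        next
          \<comment> \<open>Almost surely no sample point leaves the support, so the window carries
            the full empirical mass.\<close>
          have "(\<Sum>k\<in>{0..S+1}. 1 * ?q k) = (\<Sum>i<n. if X (Suc i) \<omega> \<in> {0..S+1} then 1 else 0) / real n"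
            by (rule emp_pmf_sum) simp
          also have "(\<Sum>i<n. if X (Suc i) \<omega> \<in> {0..S+1} then 1 else 0) = (\<Sum>i<n. 1 :: real)"
            by (intro sum.cong) (use elim in \<open>auto simp: le_SucI\<close>)
          finally show "(\<Sum>k=0..S+1. ?q k) = 1" using \<open>n > 0\<close> by simp
        qed
        \<comment> \<open>Homogeneity with factor \<open>sqrt (real n)\<close> absorbs the prefactor
          \<open>real n\<close> into the argument of \<open>T0_hat\<close>.\<close>
        then show "Tn_sq X n \<omega> = T0_hat p0 S (emp_process n \<omega>)"
          using T0_hat_scale[of "sqrt (real n)" p0 S "\<lambda>j. ?q j - p0 j"] \<open>n > 0\<close>
          by (simp add: Tn_sq_def emp_process_def[abs_def])
      qed
    qed
  qed (use limit in \<open>auto intro!: N.real_distribution_distr\<close>)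
qed

end
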